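(* Let $m$ and $n$ be positive integers with $n\equiv 3\pmod{4}$. Then \[ \sum_{k=0}^{mn-1}\frac{(1+q^{4k+1})(q^2;q^4)_k^3}{(1+q)(q^4;q^4)_k^3}\, q^k \equiv 0\pmod{\Phi_n(q)^2} \] and \[ \sum_{k=0}^{mn+(n-1)/2}\frac{(1+q^{4k+1})(q^2;q^4)_k^3}{(1+q)(q^4;q^4)_k^3}\, q^k \equiv 0\pmod{\Phi_n(q)^2}. \]
   Context: The $q$-shifted factorial is $(a;q)_0=1$ and $(a;q)_k=(1-a)(1-aq)\cdots(1-aq^{k-1})$ for $k\geqslant 1$. $\Phi_n(q)$ denotes the $n$-th cyclotomic polynomial $\prod_{1\le k\le n,\ \gcd(k,n)=1}(q-\zeta^k)$, with $\zeta$ a primitive $n$-th root of unity. For rational functions $A(q),B(q)$ with rational coefficients, $A(q)\equiv B(q)\pmod{P(q)}$ means that $A(q)-B(q)$ can be written as $P(q)\,U(q)/V(q)$ with polynomials $U,V$ and $V(q)$ relatively prime to $P(q)$. *)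

theory Defs
  imports
    Complex_Main
    "HOL-Computational_Algebra.Computational_Algebra"
    "HOL-Number_Theory.Cong"
begin

definition qshift :: "'a :: comm_ring_1 \<Rightarrow> 'a \<Rightarrow> nat \<Rightarrow> 'a" where
  "qshift a q k = (\<Prod>i<k. 1 - a * q ^ i)"

definition cyclotomic_complex :: "nat \<Rightarrow> complex poly" where
  "cyclotomic_complex n =
     (\<Prod>k | 1 \<le> k \<and> k \<le> n \<and> coprime k n. [:- (cis (2 * pi / real n) ^ k), 1:])"

text \<open>
  The product above has rational coefficients; \<open>cyclotomic n\<close> is the same polynomial viewed
  in \<open>\<rat>[q]\<close>. That it is well defined is \<open>of_rat_cyclotomic\<close> below.
\<close>

definition cyclotomic :: "nat \<Rightarrow> rat poly" where
  "cyclotomic n = (THE p. map_poly of_rat p = cyclotomic_complex n)"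

text \<open>\<open>V \<noteq> 0\<close> is implied by coprimality unless \<open>P\<close> is a nonzero constant; division by \<open>0\<close> is total in HOL.\<close>

definition ratfun_cong :: "rat poly fract \<Rightarrow> rat poly fract \<Rightarrow> rat poly \<Rightarrow> bool" where
  "ratfun_cong A B P \<longleftrightarrow>
     (\<exists>U V. V \<noteq> 0 \<and> coprime V P \<and> A - B = to_fract P * to_fract U / to_fract V)"

abbreviation qvar :: "rat poly fract" where
  "qvar \<equiv> to_fract [:0, 1:]"

lemma map_poly_of_rat_mult:
  "map_poly of_rat (p * q) = (map_poly of_rat p * map_poly of_rat q :: complex poly)"
  by (intro poly_eqI) (simp add: coeff_map_poly coeff_mult of_rat_sum of_rat_mult)

lemma map_poly_of_rat_add:
  "map_poly of_rat (p + q) = (map_poly of_rat p + map_poly of_rat q :: complex poly)"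
  by (intro poly_eqI) (simp add: coeff_map_poly of_rat_add)

lemma map_poly_of_rat_prod:
  "map_poly of_rat (\<Prod>i\<in>A. f i) = (\<Prod>i\<in>A. map_poly of_rat (f i) :: complex poly)"
  by (induction A rule: infinite_finite_induct) (simp_all add: map_poly_of_rat_mult)

lemma map_poly_of_rat_inject:
  "map_poly of_rat p = (map_poly of_rat q :: complex poly) \<longleftrightarrow> p = q"
  by (auto simp: poly_eq_iff coeff_map_poly)

lemma roots_of_unity_bij:
  assumes "n > 0"
  shows "bij_betw (\<lambda>k. cis (2 * pi / real n) ^ k) {1..n} {z. z ^ n = 1}"
proof -
  let ?z = "cis (2 * pi / real n)"
  have zk: "?z ^ k = cis (2 * pi * real k / real n)" for k
    by (simp add: DeMoivre mult_ac)
  have bij: "bij_betw (\<lambda>k. ?z ^ k) {..<n} {z. z ^ n = 1}"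
    using bij_betw_roots_unity[OF assms] by (simp add: zk)
  have "?z ^ n = 1"
    using assms by (simp add: zk)
  have mod: "?z ^ (k mod n) = ?z ^ k" for k
  proof -
    have "?z ^ k = ?z ^ (n * (k div n) + k mod n)"
      by simp
    also have "\<dots> = ?z ^ (k mod n)"
      unfolding power_add power_mult using \<open>?z ^ n = 1\<close> by simp
    finally show ?thesis by simp
  qed
  have "bij_betw (\<lambda>k. k mod n) {1..n} {..<n}"
  proof (rule bij_betw_byWitness[where f' = "\<lambda>k. if k = 0 then n else k"])
    show "\<forall>a\<in>{1..n}. (if a mod n = 0 then n else a mod n) = a"
      by (metis One_nat_def atLeastAtMost_iff le_neq_implies_less mod_less mod_self
          not_one_le_zero)
  qed (use assms in auto)
  from bij_betw_trans[OF this bij] show ?thesis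
    by (simp add: o_def mod)
qed

lemma prod_roots_of_unity:
  assumes "n > 0"
  shows "(\<Prod>k=1..n. [:- (cis (2 * pi / real n) ^ k), 1:]) = monom 1 n - 1"
proof -
  let ?R = "{z::complex. z ^ n = 1}"
  let ?p = "\<Prod>z\<in>?R. [:- z, 1:]"
  have fin: "finite ?R"
    using assms by (intro finite_roots_unity) auto
  have card: "card ?R = n"
    using assms by (rule card_roots_unity_eq)
  have deg1: "degree ?p = n"
    by (subst degree_prod_eq_sum_degree) (auto simp: card)
  have deg2: "degree (monom 1 n - 1 :: complex poly) = n"
    using assms by (subst diff_conv_add_uminus, subst degree_add_eq_left) (auto simp: degree_monom_eq)
  have "?p = monom 1 n - 1"
  proof (rule poly_eqI_degree_lead_coeff[where n = n and A = ?R])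
    have "coeff ?p n = lead_coeff ?p"
      by (simp add: deg1)
    also have "\<dots> = 1"
      by (simp add: lead_coeff_prod)
    finally show "coeff ?p n = coeff (monom 1 n - 1) n"
      using assms by simp
  next
    fix z assume "z \<in> ?R"
    then show "poly ?p z = poly (monom 1 n - 1) z"
      using fin by (auto simp: poly_prod poly_monom prod_zero_iff)
  qed (use deg1 deg2 card in auto)
  then show ?thesis
    using prod.reindex_bij_betw[OF roots_of_unity_bij[OF assms], of "\<lambda>z. [:- z, 1:]"] by simp
qed

lemma prod_cyclotomic_complex:
  assumes n: "n > 0"
  shows "(\<Prod>d | d dvd n. cyclotomic_complex d) = monom 1 n - 1"
proof -
  let ?f = "\<lambda>k. [:- (cis (2 * pi / real n) ^ k), 1:]"
  have inner: "cyclotomic_complex d = prod ?f {k \<in> {1..n}. n div gcd k n = d}" if d: "d dvd n" for d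
  proof -
    from d obtain e where e: "n = d * e" by blast
    with n have pos: "d > 0" "e > 0" by auto
    have "bij_betw (\<lambda>j. j * e) {j. 1 \<le> j \<and> j \<le> d \<and> coprime j d} {k \<in> {1..n}. n div gcd k n = d}"
    proof (rule bij_betw_byWitness[where f' = "\<lambda>k. k div e"])
      show "(\<lambda>j. j * e) ` {j. 1 \<le> j \<and> j \<le> d \<and> coprime j d} \<subseteq> {k \<in> {1..n}. n div gcd k n = d}"
      proof (safe, goal_cases)
        case (1 _ j)
        then show ?case using pos e by simp
      next
        case (2 _ j)
        have "gcd (j * e) n = gcd j d * e"
          unfolding e by (metis gcd_mult_distrib_nat mult.commute)
        with 2 show ?case using pos e by simp
      qed
      show "(\<lambda>k. k div e) ` {k \<in> {1..n}. n div gcd k n = d} \<subseteq> {j. 1 \<le> j \<and> j \<le> d \<and> coprime j d}"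
      proof
        fix j assume "j \<in> (\<lambda>k. k div e) ` {k \<in> {1..n}. n div gcd k n = d}"
        then obtain k where k: "k \<in> {1..n}" "n div gcd k n = d" "j = k div e" by auto
        have "n = d * gcd k n"
          using k(2) by (metis dvd_div_mult_self gcd_dvd2)
        with e pos have g: "gcd k n = e" by simp
        then have "e dvd k" by (metis gcd_dvd1)
        with k(3) have kj: "k = j * e" by simp
        have "gcd j d * e = e"
          using g unfolding kj e by (metis gcd_mult_distrib_nat mult.commute)
        with pos have "gcd j d = 1" by simp
        with kj k(1) e pos show "j \<in> {j. 1 \<le> j \<and> j \<le> d \<and> coprime j d}"
          by (auto simp: coprime_iff_gcd_eq_1)
      qed
      show "\<forall>j\<in>{j. 1 \<le> j \<and> j \<le> d \<and> coprime j d}. j * e div e = j"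
        using pos by simp
      show "\<forall>k\<in>{k \<in> {1..n}. n div gcd k n = d}. k div e * e = k"
      proof safe
        fix k assume "d = n div gcd k n"
        then have "n = d * gcd k n"
          by (metis dvd_div_mult_self gcd_dvd2)
        with e pos have "gcd k n = e" by simp
        then have "e dvd k" by (metis gcd_dvd1)
        then show "k div e * e = k" by simp
      qed
    qed
    then have "prod ?f {k \<in> {1..n}. n div gcd k n = d} =
        (\<Prod>j | 1 \<le> j \<and> j \<le> d \<and> coprime j d. ?f (j * e))"
      by (rule prod.reindex_bij_betw[symmetric])
    also have "\<dots> = cyclotomic_complex d"
      unfolding cyclotomic_complex_def
      by (intro prod.cong refl) (use pos in \<open>simp add: DeMoivre e field_simps\<close>)
    finally show ?thesis ..
  qed
  have "n div gcd k n dvd n" for k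
    by (metis dvd_div_mult_self dvd_triv_left gcd_dvd2)
  then have sub: "(\<lambda>k. n div gcd k n) ` {1..n} \<subseteq> {d. d dvd n}"
    by auto
  have "(\<Prod>d | d dvd n. cyclotomic_complex d) =
      (\<Prod>d | d dvd n. prod ?f {k \<in> {1..n}. n div gcd k n = d})"
    by (intro prod.cong refl inner) auto
  also have "\<dots> = prod ?f {1..n}"
    by (intro prod.group sub) (use n in auto)
  finally show ?thesis
    using prod_roots_of_unity[OF n] by simp
qed

lemma cyclotomic_complex_nonzero: "cyclotomic_complex n \<noteq> 0"
  unfolding cyclotomic_complex_def by simp

lemma cyclotomic_complex_rational: "\<exists>p. map_poly of_rat p = cyclotomic_complex n"
proof (induction n rule: less_induct)
  case (less n)
  show ?case
  proof (cases "n = 0")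
    case True
    have "{k::nat. 1 \<le> k \<and> k \<le> n \<and> coprime k n} = {}"
      using True by auto
    then have "cyclotomic_complex n = 1"
      by (simp only: cyclotomic_complex_def prod.empty)
    then show ?thesis
      by (intro exI[of _ 1]) simp
  next
    case False
    then have n: "n > 0" by simp
    define D where "D = {d. d dvd n} - {n}"
    have "\<exists>p. map_poly of_rat p = cyclotomic_complex d" if "d \<in> D" for d
      using that n by (intro less.IH) (auto simp: D_def dest: dvd_imp_le)
    then obtain f where f: "map_poly of_rat (f d) = cyclotomic_complex d" if "d \<in> D" for d
      by metis
    define r where "r = (\<Prod>d\<in>D. f d)"
    have finD: "finite D" using n by (simp add: D_def)
    have r: "map_poly of_rat r = (\<Prod>d\<in>D. cyclotomic_complex d)"
      unfolding r_def map_poly_of_rat_prod using f by (intro prod.cong) auto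
    then have r0: "r \<noteq> 0"
      using finD cyclotomic_complex_nonzero by auto
    define x where "x = (monom 1 n - 1 :: rat poly)"
    have "map_poly of_rat x = (monom 1 n - 1 :: complex poly)"
      by (intro poly_eqI) (simp add: x_def coeff_map_poly of_rat_diff coeff_monom coeff_1)
    also have "\<dots> = cyclotomic_complex n * (\<Prod>d\<in>D. cyclotomic_complex d)"
      unfolding D_def prod_cyclotomic_complex[OF n, symmetric]
      using n by (intro prod.remove) auto
    finally have "cyclotomic_complex n * map_poly of_rat r = map_poly of_rat (x div r * r + x mod r)"
      by (simp add: r)
    then have eq: "(cyclotomic_complex n - map_poly of_rat (x div r)) * map_poly of_rat r =
        map_poly of_rat (x mod r)"
      unfolding map_poly_of_rat_add map_poly_of_rat_mult by (simp add: algebra_simps)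
    have "cyclotomic_complex n - map_poly of_rat (x div r) = 0"
    proof (rule ccontr)
      assume *: "cyclotomic_complex n - map_poly of_rat (x div r) \<noteq> 0"
      have r0': "map_poly of_rat r \<noteq> (0 :: complex poly)"
        using r0 by (simp add: map_poly_eq_0_iff)
      have "degree r \<le> degree (map_poly of_rat (x mod r) :: complex poly)"
        unfolding eq[symmetric] degree_mult_eq[OF * r0'] by (simp add: degree_map_poly)
      then have "degree r \<le> degree (x mod r)"
        by (simp add: degree_map_poly)
      moreover have "x mod r \<noteq> 0"
        using eq * r0' by auto
      ultimately show False
        using degree_mod_less[OF r0, of x] by simp
    qed
    then show ?thesis
      by (intro exI[of _ "x div r"]) simp
  qed
qed

lemma of_rat_cyclotomic: "map_poly of_rat (cyclotomic n) = cyclotomic_complex n"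
proof -
  have "\<exists>!p. map_poly of_rat p = cyclotomic_complex n"
    using cyclotomic_complex_rational[of n] map_poly_of_rat_inject by metis
  then show ?thesis
    unfolding cyclotomic_def by (rule theI')
qed

end

theory Submission
  imports Defs "HOL-Computational_Algebra.Field_as_Ring"
begin

text \<open>
  Write \<open>M = (n - 1) / 2\<close> and cut the sums into blocks \<open>k = jn + r\<close> with \<open>0 \<le> r < n\<close>. For \<open>r > M\<close>
  the ratio \<open>(q\<^sup>2;q\<^sup>4)\<^sub>k / (q\<^sup>4;q\<^sup>4)\<^sub>k\<close> is divisible by \<open>\<Phi>\<^sub>n\<close>, so its cube vanishes modulo \<open>\<Phi>\<^sub>n\<^sup>2\<close>.
  For \<open>r \<le> M\<close>, a product of three factors \<open>1 - q\<^bsup>e+xn\<^esup>\<close> depends modulo \<open>\<Phi>\<^sub>n\<^sup>2\<close> only on \<open>e\<close> and on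
  the sum of the three shifts \<open>x\<close>. The cube can therefore be deformed into the summand of a
  very-well-poised \<open>\<^sub>6\<phi>\<^sub>5\<close> series with base \<open>q\<^sup>4\<close>, parameters \<open>a = q\<^bsup>8jn+2\<^esup>\<close>, \<open>b = q\<^bsup>4jn+1\<^esup>\<close>,
  \<open>c = q\<^bsup>4jn+2n+2\<^esup>\<close>, \<open>d = q\<^bsup>2-2n\<^esup>\<close> and argument \<open>q\<close>, which terminates at \<open>r = M\<close>. Its sum is
  \<open>(q\<^bsup>8jn+6\<^esup>, q\<^bsup>3-2n\<^esup>; q\<^sup>4)\<^sub>M / (q\<^bsup>4jn+5\<^esup>, q\<^bsup>4jn+4-2n\<^esup>; q\<^sup>4)\<^sub>M\<close>. The numerator contains
  \<open>1 - q\<^bsup>8jn+2n\<^esup>\<close> and, because \<open>n \<equiv> 3 (mod 4)\<close>, also \<open>1 - q\<^bsup>-n\<^esup>\<close>, whereas the denominator is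
  prime to \<open>\<Phi>\<^sub>n\<close>.
\<close>


section \<open>The terminating very-well-poised \<open>\<^sub>6\<phi>\<^sub>5\<close> summation\<close>

lemma qshift_0 [simp]: "qshift a q 0 = 1"
  by (simp add: qshift_def)

lemma qshift_Suc: "qshift a q (Suc k) = qshift a q k * (1 - a * q ^ k)"
  by (simp add: qshift_def)

lemma qshift_Suc_left: "qshift a q (Suc k) = (1 - a) * qshift (a * q) q k"
  unfolding qshift_def by (subst prod.lessThan_Suc_shift) (simp add: mult_ac)

lemma qshift_eq_0_iff:
  "qshift a q k = 0 \<longleftrightarrow> (\<exists>i<k. a * q ^ i = 1)" for a :: "'a :: idom"
  by (auto simp: qshift_def prod_zero_iff)

text \<open>The factor \<open>(1 - a * q ^ (2 * k)) / (1 - a)\<close> replaces the parameters q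
  sqrt(a), -q sqrt(a) over sqrt(a), -sqrt(a), so that no square root of \<open>a\<close> has to
  exist in the field.\<close>

definition phi65_term :: "'a :: field \<Rightarrow> 'a \<Rightarrow> 'a \<Rightarrow> 'a \<Rightarrow> 'a \<Rightarrow> nat \<Rightarrow> 'a" where
  "phi65_term q a b c d k =
     (1 - a * q ^ (2 * k)) / (1 - a) *
     (qshift a q k * qshift b q k * qshift c q k * qshift d q k) /
     (qshift q q k * qshift (a * q / b) q k * qshift (a * q / c) q k * qshift (a * q / d) q k) *
     (a * q / (b * c * d)) ^ k"

text \<open>The identity behind the telescoping in \<open>phi65_contiguous\<close>, with X = q^(K+1)
  and the common factors removed.\<close>

lemma phi65_contiguous_aux:
  fixes a b c y X :: "'a :: field"
  assumes "b \<noteq> 0" "c \<noteq> 0" "y \<noteq> 0"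
  shows "(1 - a * X\<^sup>2) * ((1 - y / b) * (1 - y / c) * (1 - a / y) * X
            - (1 - a * X / y) * (1 - y * X) * (1 - y / (b * c)))
       = (1 - a * X) * (1 - b * X) * (1 - c * X) * (1 - a * X / y) * (y / (b * c))
            - (1 - X) * (1 - a * X / b) * (1 - a * X / c) * (1 - y * X)"
proof -
  \<comment> \<open>With the inverses as further variables subject to \<open>*\<close>, the claim is
    a polynomial identity that \<open>algebra\<close> can decide.\<close>
  define b' c' y' where "b' = 1 / b" "c' = 1 / c" "y' = 1 / y"
  have *: "b * b' = 1" "c * c' = 1" "y * y' = 1"
    using assms by (auto simp: b'_c'_y'_def)
  have "(1 - a * X\<^sup>2) * ((1 - y * b') * (1 - y * c') * (1 - a * y') * X
            - (1 - a * X * y') * (1 - y * X) * (1 - y * (b' * c')))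
       = (1 - a * X) * (1 - b * X) * (1 - c * X) * (1 - a * X * y') * (y * (b' * c'))
            - (1 - X) * (1 - a * X * b') * (1 - a * X * c') * (1 - y * X)"
    using * by algebra
  then show ?thesis
    by (simp add: b'_c'_y'_def field_simps)
qed

text \<open>
  Replacing \<open>d\<close> by \<open>d / q\<close> multiplies the sum by a rational factor up to a telescoping term,
  which vanishes beyond the last summand when \<open>d = q\<^bsup>-N\<^esup>\<close>.
\<close>

lemma phi65_contiguous:
  fixes q a b c d :: "'a :: field"
  assumes nz: "q \<noteq> 0" "a \<noteq> 0" "b \<noteq> 0" "c \<noteq> 0" "d \<noteq> 0" "a \<noteq> 1"
    and q: "\<And>i. q ^ Suc i \<noteq> 1"
    and b: "\<And>i. a * q / b * q ^ i \<noteq> 1" and c: "\<And>i. a * q / c * q ^ i \<noteq> 1"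
    and d: "\<And>i. a * q / d * q ^ i \<noteq> 1"
    and bcd: "a * q / (b * c * d) \<noteq> 1"
  defines "y \<equiv> a * q / d"
  shows "(1 - y / b) * (1 - y / c) / ((1 - y) * (1 - y / (b * c))) *
           (\<Sum>k\<le>K. phi65_term q a b c (d / q) k) - (\<Sum>k\<le>K. phi65_term q a b c d k) =
         qshift (a * q) q K * qshift b q (Suc K) * qshift c q (Suc K) * qshift d q K /
         (qshift q q K * qshift (a * q / b) q K * qshift (a * q / c) q K * qshift y q (Suc K)) *
         (y / (b * c)) ^ Suc K / (1 - y / (b * c))"
    (is "?\<alpha> * _ - _ = ?g K")
proof (induction K)
  case 0
  have y: "y \<noteq> 0" "y \<noteq> 1" "1 - y / (b * c) \<noteq> 0"
    using nz d[of 0] bcd by (auto simp: y_def)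
  have "(1 - y / b) * (1 - y / c) - (1 - y) * (1 - y / (b * c)) = (1 - b) * (1 - c) * (y / (b * c))"
    using nz by (simp add: field_simps)
  moreover have "?\<alpha> - 1 = ((1 - y / b) * (1 - y / c) - (1 - y) * (1 - y / (b * c))) / ((1 - y) * (1 - y / (b * c)))"
    using y by (subst diff_divide_distrib) auto
  ultimately show ?case
    using nz y by (simp add: phi65_term_def qshift_Suc)
next
  case (Suc K)
  have y: "y \<noteq> 0" "1 - y \<noteq> 0" "1 - y / (b * c) \<noteq> 0"
    using nz d[of 0] bcd by (auto simp: y_def)
  define X where "X = q ^ Suc K"
  \<comment> \<open>\<open>H\<close> is common to both summands at \<open>Suc K\<close> and to both
    telescoping terms; what remains after extracting it is
    \<open>phi65_contiguous_aux\<close>.\<close>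
  define H where "H = qshift (a * q) q K * qshift b q (Suc K) * qshift c q (Suc K) * qshift d q K /
     (qshift q q (Suc K) * qshift (a * q / b) q (Suc K) * qshift (a * q / c) q (Suc K) *
      qshift y q (Suc (Suc K))) * (y / (b * c)) ^ Suc K"
  have q_nz: "qshift q q (Suc K) \<noteq> 0"
    using q by (auto simp: qshift_eq_0_iff)
  have b_nz: "qshift (a * q / b) q (Suc K) \<noteq> 0" and c_nz: "qshift (a * q / c) q (Suc K) \<noteq> 0"
    using b c by (auto simp: qshift_eq_0_iff)
  have y_nz: "qshift y q (Suc (Suc K)) \<noteq> 0"
    using d by (auto simp: qshift_eq_0_iff y_def)
  note Q = qshift_Suc[of q q K] qshift_Suc[of "a * q / b" q K] qshift_Suc[of "a * q / c" q K]
    qshift_Suc[of y q "Suc K"]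
  have nz': "qshift q q K \<noteq> 0" "qshift (a * q / b) q K \<noteq> 0" "qshift (a * q / c) q K \<noteq> 0"
    "qshift y q (Suc K) \<noteq> 0" "1 - X \<noteq> 0" "1 - a * X / b \<noteq> 0" "1 - a * X / c \<noteq> 0" "1 - y * X \<noteq> 0"
    using q_nz b_nz c_nz y_nz unfolding Q X_def by (auto simp: mult_ac)
  have g0: "?g K = H * ((1 - X) * (1 - a * X / b) * (1 - a * X / c) * (1 - y * X)) / (1 - y / (b * c))"
  proof -
    have H: "H = qshift (a * q) q K * qshift b q (Suc K) * qshift c q (Suc K) * qshift d q K /
     ((qshift q q K * (1 - X)) * (qshift (a * q / b) q K * (1 - a * X / b)) *
       (qshift (a * q / c) q K * (1 - a * X / c)) *
      (qshift y q (Suc K) * (1 - y * X))) * (y / (b * c)) ^ Suc K"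
      unfolding H_def Q X_def by (simp add: mult_ac)
    have *: "n / (A * B * C * D) * p / z = n / ((A * u) * (B * v) * (C * w) * (D * x)) * p * (u * v * w * x) / z"
      if "u \<noteq> 0" "v \<noteq> 0" "w \<noteq> 0" "x \<noteq> 0" for n A B C D p z u v w x :: 'a
      using that by simp
    show ?thesis
      unfolding H by (rule *) (use nz' in auto)
  qed
  have dX: "d * q ^ K = a * X / y"
    using nz by (simp add: X_def y_def field_simps)
  have g1: "?g (Suc K) = H * ((1 - a * X) * (1 - b * X) * (1 - c * X) * (1 - a * X / y) * (y / (b * c)))
      / (1 - y / (b * c))"
    unfolding qshift_Suc[of b q "Suc K"] qshift_Suc[of c q "Suc K"] qshift_Suc[of d q K]
      qshift_Suc[of "a * q" q K] dX H_def
    by (simp add: X_def mult_ac)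
  have t0: "phi65_term q a b c d (Suc K) = H * ((1 - a * X\<^sup>2) * (1 - a * X / y) * (1 - y * X))"
  proof -
    have 1: "qshift y q (Suc (Suc K)) = qshift y q (Suc K) * (1 - y * X)"
      by (simp add: Q X_def)
    have 2: "a * q / (b * c * d) = y / (b * c)"
      by (simp add: y_def)
    have 3: "q ^ (2 * Suc K) = X\<^sup>2"
      by (simp only: X_def power_even_eq)
    have 4: "a * q / d = y"
      by (simp add: y_def)
    have *: "e / (1 - a) * (((1 - a) * A) * B * C * (D * f)) / (E * Y) * p = A * B * C * D / (E * (Y * g)) * p * (e * f * g)"
      if "g \<noteq> 0" for e A B C D E f p g Y
      using that nz by simp
    show ?thesis
      unfolding phi65_term_def H_def qshift_Suc_left[of a q K] qshift_Suc[of d q K] dX 1 2 3 4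
      using nz'(8) by (rule *)
  qed
  have t1: "phi65_term q a b c (d / q) (Suc K) = H * ((1 - a * X\<^sup>2) * (1 - a / y) * (1 - y) * X)"
  proof -
    have 1: "qshift y q (Suc (Suc K)) = (1 - y) * qshift (y * q) q (Suc K)"
      by (rule qshift_Suc_left)
    have 2: "a * q / (b * c * (d / q)) = (y / (b * c)) * q"
      using nz by (simp add: y_def)
    have 3: "q ^ (2 * Suc K) = X\<^sup>2"
      by (simp only: X_def power_even_eq)
    have 4: "a * q / (d / q) = y * q"
      by (simp add: y_def)
    have 5: "qshift (d / q) q (Suc K) = (1 - a / y) * qshift d q K"
      using nz by (simp add: qshift_Suc_left y_def)
    have 6: "((y / (b * c)) * q) ^ Suc K = (y / (b * c)) ^ Suc K * X"
      by (simp only: X_def power_mult_distrib)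
    have *: "e / (1 - a) * (((1 - a) * A) * B * C * (f * D)) / (E * Y) * (p * x) = A * B * C * D / (E * (g * Y)) * p * (e * f * g * x)"
      if "g \<noteq> 0" for e A B C D E f p g x Y
      using that nz by simp
    show ?thesis
      unfolding phi65_term_def H_def qshift_Suc_left[of a q K] 1 2 3 4 5 6
      using y(2) by (rule *)
  qed
  have "?\<alpha> * phi65_term q a b c (d / q) (Suc K) - phi65_term q a b c d (Suc K) =
     H * ((1 - a * X\<^sup>2) * ((1 - y / b) * (1 - y / c) * (1 - a / y) * X
            - (1 - a * X / y) * (1 - y * X) * (1 - y / (b * c)))) / (1 - y / (b * c))"
  proof -
    have *: "s * t / (u * z) * (h * (e * f * u * x)) - h * (e * k * l) = h * (e * (s * t * f * x - k * l * z)) / z"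
      if "u \<noteq> 0" "z \<noteq> 0" for s t u z h e f x k l :: 'a
      using that by (simp add: field_simps)
    show ?thesis
      unfolding t0 t1 using y by (intro *)
  qed
  also have "\<dots> = ?g (Suc K) - ?g K"
    unfolding g0 g1 phi65_contiguous_aux[OF nz(3,4) y(1)]
    by (simp only: diff_divide_distrib right_diff_distrib)
  finally have step: "?\<alpha> * phi65_term q a b c (d / q) (Suc K) - phi65_term q a b c d (Suc K) = ?g (Suc K) - ?g K" .
  have alg: "al * (s + u) - (t + v) = z" if "al * s - t = w" "al * u - v = z - w" for al s t u v z w :: 'a
    using that by (simp add: algebra_simps)
  show ?case
    unfolding sum.atMost_Suc by (rule alg[OF Suc.IH step])
qed

lemma phi65_term_eq_0:
  "N < k \<Longrightarrow> q \<noteq> 0 \<Longrightarrow> phi65_term q a b c (1 / q ^ N) k = 0"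
  by (auto simp: phi65_term_def qshift_eq_0_iff)

text \<open>By induction on \<open>N\<close>: passing from d = q^(-N) to d / q with
  \<open>phi65_contiguous\<close> multiplies the sum by one further factor of each of the four
  products.\<close>

theorem phi65_terminating:
  fixes q a b c :: "'a :: field"
  assumes nz: "q \<noteq> 0" "a \<noteq> 0" "b \<noteq> 0" "c \<noteq> 0"
    and q: "\<And>i. q ^ Suc i \<noteq> 1" and a: "\<And>i. a * q ^ i \<noteq> 1"
    and b: "\<And>i. a * q / b * q ^ i \<noteq> 1" and c: "\<And>i. a * q / c * q ^ i \<noteq> 1"
    and bc: "\<And>i. a * q / (b * c) * q ^ i \<noteq> 1"
  shows "(\<Sum>k\<le>N. phi65_term q a b c (1 / q ^ N) k) =
    qshift (a * q) q N * qshift (a * q / (b * c)) q N /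
    (qshift (a * q / b) q N * qshift (a * q / c) q N)"
proof (induction N)
  case 0
  show ?case using a[of 0] by (simp add: phi65_term_def)
next
  case (Suc N)
  define d where "d = 1 / q ^ N"
  define y where "y = a * q / d"
  have y: "y = a * q * q ^ N"
    by (simp add: y_def d_def)
  have fac: "1 - y \<noteq> 0" "1 - y / b \<noteq> 0" "1 - y / c \<noteq> 0" "1 - y / (b * c) \<noteq> 0"
    using a[of "Suc N"] b[of N] c[of N] bc[of N] by (auto simp: y mult_ac)
  \<comment> \<open>Since d q^N = 1, the boundary term of the contiguous relation is zero at K = N +
    1.\<close>
  have vanish: "qshift d q (Suc N) = 0"
    using nz by (auto simp: qshift_eq_0_iff d_def)
  have "(1 - y / b) * (1 - y / c) / ((1 - y) * (1 - y / (b * c))) *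
           (\<Sum>k\<le>Suc N. phi65_term q a b c (d / q) k) - (\<Sum>k\<le>Suc N. phi65_term q a b c d k) = 0"
    unfolding y_def
  proof (subst phi65_contiguous[OF nz])
    fix i show "a * q / d * q ^ i \<noteq> 1"
      using a[of "Suc (N + i)"] by (simp add: d_def power_add mult_ac)
    show "a * q / (b * c * d) \<noteq> 1"
      using bc[of N] by (simp add: d_def)
  qed (use nz q a[of 0] b c vanish in \<open>auto simp: d_def\<close>)
  \<comment> \<open>The relation needs the same range for both sums, but the series for
    \<open>d\<close> already stops at \<open>N\<close>.\<close>
  moreover have "(\<Sum>k\<le>Suc N. phi65_term q a b c d k) = (\<Sum>k\<le>N. phi65_term q a b c d k)"
    using phi65_term_eq_0[of N "Suc N" q a b c] nz by (simp add: d_def)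
  moreover have *: "S = T * (u * z / (s * t))"
    if "s * t / (u * z) * S - T = 0" "s \<noteq> 0" "t \<noteq> 0" "u \<noteq> 0" "z \<noteq> 0" for s t u z S T :: 'a
    using that by (simp add: field_simps)
  ultimately have "(\<Sum>k\<le>Suc N. phi65_term q a b c (d / q) k) =
      (\<Sum>k\<le>N. phi65_term q a b c d k) * ((1 - y) * (1 - y / (b * c)) / ((1 - y / b) * (1 - y / c)))"
    by (intro *) (use fac in simp_all)
  also have "d / q = 1 / q ^ Suc N"
    by (simp add: d_def mult.commute)
  finally show ?case
    unfolding Suc.IH[folded d_def] qshift_Suc y by (simp add: mult_ac)
qed


section \<open>Localization at a polynomial\<close>

text \<open>These are the rational functions that can be reduced modulo \<open>P\<close>. In this
  ring \<open>loc_ideal P k\<close> is the ideal generated by \<open>P ^ k\<close>, and membership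
  in it yields \<open>ratfun_cong\<close>.\<close>

definition localization :: "rat poly \<Rightarrow> rat poly fract set" where
  "localization P = {to_fract p / to_fract s | p s. s \<noteq> 0 \<and> coprime s P}"

definition loc_ideal :: "rat poly \<Rightarrow> nat \<Rightarrow> rat poly fract set" where
  "loc_ideal P k = (\<lambda>z. to_fract P ^ k * z) ` localization P"

text \<open>The condition \<open>x \<noteq> 0\<close> excludes 0, whose inverse in HOL is 0
  again.\<close>

definition loc_unit :: "rat poly \<Rightarrow> rat poly fract \<Rightarrow> bool" where
  "loc_unit P x \<longleftrightarrow> x \<noteq> 0 \<and> x \<in> localization P \<and> inverse x \<in> localization P"

lemma localizationI: "s \<noteq> 0 \<Longrightarrow> coprime s P \<Longrightarrow> to_fract p / to_fract s \<in> localization P"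
  by (auto simp: localization_def)

lemma localizationE:
  assumes "x \<in> localization P"
  obtains p s where "s \<noteq> 0" "coprime s P" "x = to_fract p / to_fract s"
  using assms by (auto simp: localization_def)

lemma loc_to_fract [simp]: "to_fract p \<in> localization P"
  using localizationI[of 1 P p] by simp

lemma loc_0 [simp]: "0 \<in> localization P"
  using loc_to_fract[of 0] by simp

lemma loc_1 [simp]: "1 \<in> localization P"
  using loc_to_fract[of 1] by simp

lemma loc_add: "x \<in> localization P \<Longrightarrow> y \<in> localization P \<Longrightarrow> x + y \<in> localization P"
proof (elim localizationE)
  fix p s p' s' assume *: "s \<noteq> 0" "coprime s P" "x = to_fract p / to_fract s"
    "s' \<noteq> 0" "coprime s' P" "y = to_fract p' / to_fract s'"
  then have eq: "x + y = to_fract (p * s' + p' * s) / to_fract (s * s')"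
    by (simp add: add_frac_eq)
  show ?thesis
    unfolding eq by (rule localizationI) (use * in simp_all)
qed

lemma loc_mult: "x \<in> localization P \<Longrightarrow> y \<in> localization P \<Longrightarrow> x * y \<in> localization P"
proof (elim localizationE)
  fix p s p' s' assume *: "s \<noteq> 0" "coprime s P" "x = to_fract p / to_fract s"
    "s' \<noteq> 0" "coprime s' P" "y = to_fract p' / to_fract s'"
  then have eq: "x * y = to_fract (p * p') / to_fract (s * s')"
    by simp
  show ?thesis
    unfolding eq by (rule localizationI) (use * in simp_all)
qed

lemma loc_uminus: "x \<in> localization P \<Longrightarrow> - x \<in> localization P"
  using loc_mult[OF loc_to_fract[of "-1" P], of x] by simp

lemma loc_diff: "x \<in> localization P \<Longrightarrow> y \<in> localization P \<Longrightarrow> x - y \<in> localization P"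
  using loc_add[OF _ loc_uminus, of x P y] by simp

lemma loc_power: "x \<in> localization P \<Longrightarrow> x ^ k \<in> localization P"
  by (induction k) (auto intro: loc_mult)

lemma loc_of_nat: "of_nat x \<in> localization P"
  by (induction x) (auto intro: loc_add)

lemma loc_of_int: "of_int x \<in> localization P"
  by (cases x) (auto intro: loc_of_nat loc_uminus simp del: of_nat_Suc)

lemma loc_sum: "(\<And>i. i \<in> A \<Longrightarrow> f i \<in> localization P) \<Longrightarrow> sum f A \<in> localization P"
  by (induction A rule: infinite_finite_induct) (auto intro: loc_add)

lemma loc_prod: "(\<And>i. i \<in> A \<Longrightarrow> f i \<in> localization P) \<Longrightarrow> prod f A \<in> localization P"
  by (induction A rule: infinite_finite_induct) (auto intro: loc_mult)

lemma loc_unitD: "loc_unit P x \<Longrightarrow> x \<in> localization P"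
  by (simp add: loc_unit_def)

lemma loc_divide: "x \<in> localization P \<Longrightarrow> loc_unit P y \<Longrightarrow> x / y \<in> localization P"
  unfolding divide_inverse by (intro loc_mult) (auto simp: loc_unit_def)

lemma loc_unit_mult: "loc_unit P x \<Longrightarrow> loc_unit P y \<Longrightarrow> loc_unit P (x * y)"
  by (auto simp: loc_unit_def intro: loc_mult)

lemma loc_unit_inverse: "loc_unit P x \<Longrightarrow> loc_unit P (inverse x)"
  by (auto simp: loc_unit_def)

lemma loc_unit_uminus: "loc_unit P x \<Longrightarrow> loc_unit P (- x)"
  by (auto simp: loc_unit_def intro: loc_uminus)

lemma loc_unit_divide: "loc_unit P x \<Longrightarrow> loc_unit P y \<Longrightarrow> loc_unit P (x / y)"
  unfolding divide_inverse by (intro loc_unit_mult loc_unit_inverse)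

lemma loc_unit_1: "loc_unit P 1"
  by (simp add: loc_unit_def)

lemma loc_unit_power: "loc_unit P x \<Longrightarrow> loc_unit P (x ^ k)"
  by (induction k) (auto intro: loc_unit_mult loc_unit_1)

lemma loc_unit_power_int: "loc_unit P x \<Longrightarrow> loc_unit P (x powi k)"
  by (auto simp: power_int_def intro: loc_unit_power loc_unit_inverse)

lemma loc_unit_prod: "(\<And>i. i \<in> A \<Longrightarrow> loc_unit P (f i)) \<Longrightarrow> loc_unit P (prod f A)"
  by (induction A rule: infinite_finite_induct) (auto intro: loc_unit_mult loc_unit_1)

lemma loc_unit_to_fract: "s \<noteq> 0 \<Longrightarrow> coprime s P \<Longrightarrow> loc_unit P (to_fract s)"
  using localizationI[of s P 1] by (simp add: loc_unit_def inverse_eq_divide)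

lemma loc_ideal_0 [simp]: "0 \<in> loc_ideal P k"
  by (auto simp: loc_ideal_def intro!: image_eqI[of _ _ 0])

lemma loc_ideal_add: "x \<in> loc_ideal P k \<Longrightarrow> y \<in> loc_ideal P k \<Longrightarrow> x + y \<in> loc_ideal P k"
  by (auto simp: loc_ideal_def ring_distribs [symmetric] intro!: imageI loc_add)

lemma loc_ideal_mult:
  assumes "x \<in> loc_ideal P i" "y \<in> loc_ideal P k"
  shows "x * y \<in> loc_ideal P (i + k)"
proof -
  from assms obtain u v where uv: "u \<in> localization P" "v \<in> localization P"
    "x = to_fract P ^ i * u" "y = to_fract P ^ k * v"
    by (auto simp: loc_ideal_def)
  then have "x * y = to_fract P ^ (i + k) * (u * v)"
    by (simp add: power_add mult_ac)
  with uv show ?thesis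
    unfolding loc_ideal_def by (intro image_eqI[of _ _ "u * v"] loc_mult)
qed

lemma loc_ideal_zero_eq: "loc_ideal P 0 = localization P"
  by (auto simp: loc_ideal_def)

lemma loc_ideal_mult_left: "x \<in> localization P \<Longrightarrow> y \<in> loc_ideal P k \<Longrightarrow> x * y \<in> loc_ideal P k"
  using loc_ideal_mult[of x P 0 y k] by (simp add: loc_ideal_zero_eq)

lemma loc_ideal_mult_right: "x \<in> loc_ideal P k \<Longrightarrow> y \<in> localization P \<Longrightarrow> x * y \<in> loc_ideal P k"
  using loc_ideal_mult_left[of y P x k] by (simp add: mult.commute)

lemma loc_ideal_divide: "x \<in> loc_ideal P k \<Longrightarrow> loc_unit P y \<Longrightarrow> x / y \<in> loc_ideal P k"
  unfolding divide_inverse by (intro loc_ideal_mult_right) (auto simp: loc_unit_def)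

lemma loc_ideal_diff: "x \<in> loc_ideal P k \<Longrightarrow> y \<in> loc_ideal P k \<Longrightarrow> x - y \<in> loc_ideal P k"
  by (auto simp: loc_ideal_def ring_distribs [symmetric] intro!: imageI loc_diff)

lemma loc_ideal_uminus: "x \<in> loc_ideal P k \<Longrightarrow> - x \<in> loc_ideal P k"
  using loc_ideal_diff[of 0 P k x] by simp

lemma loc_ideal_sum: "(\<And>i. i \<in> A \<Longrightarrow> f i \<in> loc_ideal P k) \<Longrightarrow> sum f A \<in> loc_ideal P k"
  by (induction A rule: infinite_finite_induct) (auto intro: loc_ideal_add)

lemma loc_ideal_prod:
  assumes "finite A" "i \<in> A" "f i \<in> loc_ideal P k" "\<And>i. i \<in> A \<Longrightarrow> f i \<in> localization P"
  shows "prod f A \<in> loc_ideal P k"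
  unfolding prod.remove[OF assms(1,2)]
  by (intro loc_ideal_mult_right loc_prod) (use assms in auto)

lemma loc_ideal_antimono: "i \<le> k \<Longrightarrow> loc_ideal P k \<subseteq> loc_ideal P i"
proof
  fix x assume "i \<le> k" "x \<in> loc_ideal P k"
  then obtain z where "z \<in> localization P" "x = to_fract P ^ i * (to_fract P ^ (k - i) * z)"
    by (auto simp: loc_ideal_def mult.assoc [symmetric] power_add [symmetric])
  then show "x \<in> loc_ideal P i"
    by (auto simp: loc_ideal_def intro!: loc_mult loc_power)
qed

lemma ratfun_cong_0I:
  assumes "x \<in> loc_ideal P k"
  shows "ratfun_cong x 0 (P ^ k)"
proof -
  from assms obtain z where "z \<in> localization P" and x: "x = to_fract P ^ k * z"
    by (auto simp: loc_ideal_def)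
  then obtain p s where "s \<noteq> 0" "coprime s P" "z = to_fract p / to_fract s"
    by (auto elim: localizationE)
  moreover have "to_fract P ^ k = to_fract (P ^ k)"
    by (induction k) auto
  ultimately show ?thesis
    unfolding ratfun_cong_def x by - (rule exI[of _ p], rule exI[of _ s], simp)
qed

section \<open>Congruences modulo powers of P in the localization\<close>

text \<open>Both sides must lie in the localization, so that congruences can be multiplied.\<close>

definition lcong :: "rat poly \<Rightarrow> nat \<Rightarrow> rat poly fract \<Rightarrow> rat poly fract \<Rightarrow> bool" where
  "lcong P k x y \<longleftrightarrow> x \<in> localization P \<and> y \<in> localization P \<and> x - y \<in> loc_ideal P k"

lemma lcong_refl: "x \<in> localization P \<Longrightarrow> lcong P k x x"
  by (simp add: lcong_def)

lemma lcong_sym: "lcong P k x y \<Longrightarrow> lcong P k y x"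
  unfolding lcong_def using loc_ideal_uminus[of "x - y" P k] by simp

lemma lcong_trans [trans]: "lcong P k x y \<Longrightarrow> lcong P k y z \<Longrightarrow> lcong P k x z"
  unfolding lcong_def using loc_ideal_add[of "x - y" P k "y - z"] by simp

lemma lcong_mult:
  assumes "lcong P k x x'" "lcong P k y y'"
  shows "lcong P k (x * y) (x' * y')"
proof -
  have "x * y - x' * y' = (x - x') * y + x' * (y - y')"
    by (simp add: algebra_simps)
  then show ?thesis
    using assms unfolding lcong_def
    by (auto intro!: loc_mult loc_ideal_add intro: loc_ideal_mult_left loc_ideal_mult_right)
qed

text \<open>1/y - 1/y' = (y' - y) / (y y'), and the denominator is a unit.\<close>

lemma lcong_divide:
  assumes "lcong P k x x'" "lcong P k y y'" "loc_unit P y" "loc_unit P y'"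
  shows "lcong P k (x / y) (x' / y')"
proof -
  have nz: "y \<noteq> 0" "y' \<noteq> 0"
    using assms by (auto simp: loc_unit_def)
  have "inverse y - inverse y' = (y' - y) / (y * y')"
    using nz by (simp add: field_simps)
  moreover have "(y' - y) / (y * y') \<in> loc_ideal P k"
    using assms lcong_sym[OF assms(2)] by (intro loc_ideal_divide loc_unit_mult) (auto simp: lcong_def)
  ultimately have "lcong P k (inverse y) (inverse y')"
    using assms by (auto simp: lcong_def loc_unit_def)
  from lcong_mult[OF assms(1) this] show ?thesis
    by (simp add: divide_inverse)
qed

lemma lcong_prod:
  "(\<And>i. i \<in> A \<Longrightarrow> lcong P k (f i) (g i)) \<Longrightarrow> lcong P k (prod f A) (prod g A)"
  by (induction A rule: infinite_finite_induct) (auto intro: lcong_mult lcong_refl)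

lemma lcong_idealD: "lcong P k x y \<Longrightarrow> y \<in> loc_ideal P k \<Longrightarrow> x \<in> loc_ideal P k"
  unfolding lcong_def using loc_ideal_add[of "x - y" P k y] by simp

lemma lcong_sum:
  "(\<And>i. i \<in> A \<Longrightarrow> lcong P k (f i) (g i)) \<Longrightarrow> lcong P k (sum f A) (sum g A)"
  by (auto simp: lcong_def sum_subtractf [symmetric] intro: loc_sum loc_ideal_sum)


section \<open>Units and multiples of the cyclotomic polynomial\<close>

lemma cyclotomic_nonzero: "cyclotomic n \<noteq> 0"
  using of_rat_cyclotomic[of n] cyclotomic_complex_nonzero[of n] by auto

text \<open>A root is w^k with w primitive and k prime to n, hence it has exact order n.\<close>

lemma poly_cyclotomic_complex_eq_0D:
  assumes "n > 0" "poly (cyclotomic_complex n) z = 0"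
  shows "z ^ e = 1 \<longleftrightarrow> n dvd e"
proof -
  define w where "w = cis (2 * pi / real n)"
  obtain k where k: "coprime k n" and z: "z = w ^ k"
    using assms(2) by (auto simp: cyclotomic_complex_def poly_prod prod_zero_iff w_def)
  note bij = roots_of_unity_bij[OF assms(1), folded w_def]
  have wn: "w ^ n = 1"
    using assms(1) by (simp add: w_def DeMoivre)
  have "n dvd e" if "z ^ e = 1"
  proof -
    have "w ^ (k * e) = w ^ (n * (k * e div n) + k * e mod n)"
      by simp
    also have "\<dots> = w ^ (k * e mod n)"
      unfolding power_add power_mult by (simp add: wn)
    \<comment> \<open>The value 1 is written as \<open>w ^ n\<close> because the bijection ranges
      over the exponents 1 to n.\<close>
    finally have *: "w ^ (k * e mod n) = w ^ n"
      using that by (simp add: z power_mult wn)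
    have "k * e mod n = 0"
    proof (rule ccontr)
      assume "k * e mod n \<noteq> 0"
      then have "k * e mod n = n"
        using * assms(1) by (intro inj_onD[OF bij_betw_imp_inj_on[OF bij]]) (auto simp: less_imp_le)
      then show False
        using mod_less_divisor[OF assms(1), of "k * e"] by simp
    qed
    then have "n dvd k * e"
      by auto
    then show ?thesis
      using k by (metis coprime_commute coprime_dvd_mult_right_iff)
  qed
  moreover have "z ^ e = 1" if "n dvd e"
  proof -
    have "z ^ n = 1"
      by (simp add: z power_mult [symmetric] mult.commute[of k]) (simp add: power_mult wn)
    with that show ?thesis
      by (auto simp: dvd_def power_mult)
  qed
  ultimately show ?thesis by blast
qed

text \<open>A nonconstant common divisor would have a complex root, by the fundamental theorem of
  algebra, and this would be a common root.\<close>

lemma coprime_cyclotomicI: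
  assumes "\<And>z. poly (cyclotomic_complex n) z = 0 \<Longrightarrow> poly (map_poly of_rat s) z \<noteq> 0"
  shows "coprime s (cyclotomic n)"
proof (rule coprimeI)
  fix c assume c: "c dvd s" "c dvd cyclotomic n"
  then obtain u v where uv: "s = c * u" "cyclotomic n = c * v"
    by (auto simp: dvd_def)
  have c0: "c \<noteq> 0"
    using c(2) cyclotomic_nonzero by auto
  have "degree c = 0"
  proof (rule ccontr)
    assume "degree c \<noteq> 0"
    then have "degree (map_poly of_rat c :: complex poly) \<noteq> 0"
      by (simp add: degree_map_poly)
    then obtain z :: complex where z: "poly (map_poly of_rat c) z = 0"
      using fundamental_theorem_of_algebra[of "map_poly of_rat c"] by (auto simp: constant_degree)
    have "poly (cyclotomic_complex n) z = 0" "poly (map_poly of_rat s) z = 0"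
      using z by (simp_all add: of_rat_cyclotomic [symmetric] uv map_poly_of_rat_mult)
    then show False
      using assms by blast
  qed
  with c0 show "is_unit c"
    by (simp add: is_unit_iff_degree)
qed

lemma cyclotomic_dvd:
  assumes "n > 0"
  shows "cyclotomic n dvd monom 1 n - 1"
proof -
  have "map_poly of_rat (\<Prod>d | d dvd n. cyclotomic d) = (map_poly of_rat (monom 1 n - 1) :: complex poly)"
    unfolding map_poly_of_rat_prod of_rat_cyclotomic prod_cyclotomic_complex[OF assms]
    by (intro poly_eqI) (simp add: coeff_map_poly of_rat_diff coeff_monom coeff_1)
  then have "(\<Prod>d | d dvd n. cyclotomic d) = monom 1 n - 1"
    unfolding map_poly_of_rat_inject .
  then show ?thesis
    using assms dvd_prodI[of "{d. d dvd n}" n cyclotomic] by simp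
qed

lemma to_fract_monom: "to_fract (monom 1 k) = qvar ^ k"
proof (induction k)
  case (Suc k)
  have "monom 1 (Suc k) = [:0, 1:] * (monom 1 k :: rat poly)"
    by (simp add: monom_Suc)
  then show ?case
    by (simp only: to_fract_mult Suc power_Suc)
qed simp

lemma qvar_nonzero: "qvar \<noteq> 0"
  by simp

section \<open>The factors 1 - q^e modulo Phi_n\<close>

text \<open>Exponents are integers because the deformed series contains negative powers such as
  q^(2-2n).\<close>

definition qfac :: "int \<Rightarrow> rat poly fract" where
  "qfac e = 1 - qvar powi e"

lemma qfac_uminus: "qfac (- e) = - (qvar powi (- e) * qfac e)"
  by (simp add: qfac_def power_int_minus field_simps)

lemma qfac_of_nat: "qfac (int k) = to_fract (1 - monom 1 k)"
  by (simp add: qfac_def to_fract_monom)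

lemma qfac_double: "qfac (2 * e) = qfac e * (1 + qvar powi e)"
proof -
  have "qvar powi (2 * e) = qvar powi e * qvar powi e"
    unfolding mult_2 by (intro power_int_add disjI1 qvar_nonzero)
  then show ?thesis
    by (simp add: qfac_def algebra_simps)
qed

lemma qfac_nonzero: "e \<noteq> 0 \<Longrightarrow> qfac e \<noteq> 0"
proof -
  have *: "qfac (int k) \<noteq> 0" if "k > 0" for k
  proof -
    have "coeff (1 - monom 1 k :: rat poly) 0 \<noteq> 0"
      using that by simp
    then show ?thesis
      unfolding qfac_of_nat by (metis coeff_0 to_fract_eq_0_iff)
  qed
  assume "e \<noteq> 0"
  then show ?thesis
    using *[of "nat e"] *[of "nat (- e)"] qfac_uminus[of "- e"] by (cases "e > 0") auto
qed

lemma loc_unit_qvar: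
  assumes "n > 0"
  shows "loc_unit (cyclotomic n) qvar"
proof (intro loc_unit_to_fract coprime_cyclotomicI)
  fix z :: complex assume "poly (cyclotomic_complex n) z = 0"
  then have "z ^ n = 1"
    using poly_cyclotomic_complex_eq_0D[OF assms] by auto
  then show "poly (map_poly of_rat [:0, 1:]) z \<noteq> 0"
    using assms by (auto simp: map_poly_pCons power_0_left)
qed simp

lemma loc_qfac: "n > 0 \<Longrightarrow> qfac e \<in> localization (cyclotomic n)"
  unfolding qfac_def by (intro loc_diff loc_1 loc_unitD[OF loc_unit_power_int[OF loc_unit_qvar]])

text \<open>A root z of Phi_n has exact order n, so 1 - z^k does not vanish; negative exponents only
  bring in the unit -q^e.\<close>

lemma loc_unit_qfac:
  assumes "n > 0" "\<not> int n dvd e"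
  shows "loc_unit (cyclotomic n) (qfac e)"
proof -
  have *: "loc_unit (cyclotomic n) (qfac (int k))" if "\<not> n dvd k" for k
    unfolding qfac_of_nat
  proof (intro loc_unit_to_fract coprime_cyclotomicI)
    fix z :: complex assume "poly (cyclotomic_complex n) z = 0"
    then have "z ^ k \<noteq> 1"
      using poly_cyclotomic_complex_eq_0D[OF assms(1)] that by auto
    moreover have "map_poly of_rat (1 - monom 1 k) = (1 - monom 1 k :: complex poly)"
      by (intro poly_eqI) (simp add: coeff_map_poly of_rat_diff coeff_monom coeff_1)
    ultimately show "poly (map_poly of_rat (1 - monom 1 k)) z \<noteq> 0"
      by (simp add: poly_monom)
  next
    show "1 - monom 1 k \<noteq> (0 :: rat poly)"
      using qfac_nonzero[of "int k"] that unfolding qfac_of_nat by (cases "k = 0") auto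
  qed
  show ?thesis
  proof (cases e rule: int_cases2)
    case (nonneg k)
    with * assms(2) show ?thesis by auto
  next
    case (nonpos k)
    have eq: "qfac e = - (qvar powi e * qfac (int k))"
      using qfac_uminus[of "int k"] by (simp add: nonpos)
    have "loc_unit (cyclotomic n) (qfac (int k))"
      using * assms(2) nonpos by auto
    then show ?thesis
      unfolding eq by (intro loc_unit_uminus loc_unit_mult loc_unit_power_int loc_unit_qvar assms(1))
  qed
qed

lemma loc_ideal_qfac:
  assumes "n > 0" "int n dvd e"
  shows "qfac e \<in> loc_ideal (cyclotomic n) 1"
proof -
  have *: "qfac (int k) \<in> loc_ideal (cyclotomic n) 1" if "n dvd k" for k
  proof -
    have "monom 1 n - 1 dvd (monom 1 n ^ (k div n) - 1 :: rat poly)"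
      by (simp add: power_diff_1_eq)
    also have "monom 1 n ^ (k div n) = (monom 1 k :: rat poly)"
      using that by (simp add: monom_power)
    finally have "cyclotomic n dvd 1 - monom 1 k"
      using cyclotomic_dvd[OF assms(1)] by (meson dvd_diff_commute dvd_trans)
    then obtain r where "1 - monom 1 k = cyclotomic n * r"
      by (auto simp: dvd_def)
    then show ?thesis
      unfolding qfac_of_nat loc_ideal_def by (intro image_eqI[of _ _ "to_fract r"]) simp_all
  qed
  show ?thesis
  proof (cases e rule: int_cases2)
    case (nonneg k)
    with * assms(2) show ?thesis by auto
  next
    case (nonpos k)
    have eq: "qfac e = - (qvar powi e * qfac (int k))"
      using qfac_uminus[of "int k"] by (simp add: nonpos)
    have "qfac (int k) \<in> loc_ideal (cyclotomic n) 1"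
      using * assms(2) nonpos by auto
    then show ?thesis
      unfolding eq
      by (intro loc_ideal_uminus loc_ideal_mult_left loc_unitD[OF loc_unit_power_int] loc_unit_qvar assms(1))
  qed
qed

text \<open>At a root of Phi_n every term is 1, so the sum has the value \<open>l\<close>, which is
  nonzero. This controls (1 - q^(kl)) / (1 - q^k), where Phi_n divides both parts.\<close>

lemma loc_unit_geometric_sum:
  assumes "n > 0" "n dvd k" "l > 0"
  shows "loc_unit (cyclotomic n) (\<Sum>i<l. (qvar ^ k) ^ i)"
proof -
  define s :: "rat poly" where "s = (\<Sum>i<l. monom 1 (k * i))"
  have s: "poly (map_poly of_rat s) z = (\<Sum>i<l. z ^ (k * i))" for z :: complex
  proof -
    have "map_poly of_rat s = (\<Sum>i<l. monom 1 (k * i) :: complex poly)"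
      by (intro poly_eqI) (simp add: s_def coeff_map_poly coeff_sum of_rat_sum if_distrib[of of_rat] cong: if_cong)
    then show ?thesis
      by (simp add: poly_sum poly_monom)
  qed
  have "poly (map_poly of_rat s) z \<noteq> 0" if "poly (cyclotomic_complex n) z = 0" for z :: complex
    using poly_cyclotomic_complex_eq_0D[OF assms(1) that, of k] assms
    by (simp add: s power_mult)
  then have "coprime s (cyclotomic n)"
    by (rule coprime_cyclotomicI)
  moreover have "poly (map_poly of_rat s) (1 :: complex) \<noteq> 0"
    unfolding s using assms(3) by simp
  then have "s \<noteq> 0"
    by auto
  moreover have "to_fract s = (\<Sum>i<l. (qvar ^ k) ^ i)"
    by (simp only: s_def to_fract_sum to_fract_monom power_mult)
  ultimately show ?thesis
    using loc_unit_to_fract by metis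
qed

section \<open>First-order expansion modulo Phi_n^2\<close>

text \<open>For z = q^n, the power z^x is 1 + x (z - 1) up to multiples of (z - 1)^2, and Phi_n
  divides z - 1. The induction runs from 0 in both directions.\<close>

lemma loc_ideal_qvar_power_int_linear:
  assumes n: "n > 0"
  shows "qvar powi (x * int n) - 1 - of_int x * (qvar ^ n - 1) \<in> loc_ideal (cyclotomic n) 2"
proof (induction x rule: int_induct[where k = 0])
  case base
  show ?case by simp
next
  define z where "z = qvar ^ n"
  have z0: "z \<noteq> 0"
    by (simp add: z_def)
  have z_pow: "qvar powi (x * int n) = z powi x" for x
    by (simp add: z_def power_int_mult mult.commute[of x])
  have loc_z: "loc_unit (cyclotomic n) z"
    unfolding z_def by (intro loc_unit_power loc_unit_qvar n)
  have "qfac (int n) * qfac (int n) \<in> loc_ideal (cyclotomic n) (1 + 1)"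
    by (intro loc_ideal_mult loc_ideal_qfac n) auto
  then have sq: "(z - 1)\<^sup>2 \<in> loc_ideal (cyclotomic n) 2"
    by (simp add: qfac_def z_def power2_eq_square algebra_simps numeral_2_eq_2)
  {
    case (step1 x)
    have "z powi (x + 1) = z * z powi x"
      using z0 by (simp add: power_int_add_1')
    then have "z powi (x + 1) - 1 - of_int (x + 1) * (z - 1) =
        z * (z powi x - 1 - of_int x * (z - 1)) + of_int x * (z - 1)\<^sup>2"
      by (simp only:) (simp add: power2_eq_square algebra_simps)
    also have "\<dots> \<in> loc_ideal (cyclotomic n) 2"
      using step1 sq unfolding z_pow z_def[symmetric]
      by (intro loc_ideal_add loc_ideal_mult_left loc_of_int loc_unitD loc_z) auto
    finally show ?case
      unfolding z_pow z_def[symmetric] .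
  next
    case (step2 x)
    have "z powi (x - 1) = z powi x / z"
      using z0 by (simp add: power_int_diff)
    then have "z powi (x - 1) - 1 - of_int (x - 1) * (z - 1) =
        ((z powi x - 1 - of_int x * (z - 1)) - of_int (x - 1) * (z - 1)\<^sup>2) / z"
      using z0 by (simp add: power2_eq_square field_simps)
    also have "\<dots> \<in> loc_ideal (cyclotomic n) 2"
      using step2 sq unfolding z_pow z_def[symmetric]
      by (intro loc_ideal_divide[OF loc_ideal_diff[OF _ loc_ideal_mult_left]] loc_of_int loc_z) auto
    finally show ?case
      unfolding z_pow z_def[symmetric] .
  }
qed

lemma lcong_qfac_shift:
  assumes n: "n > 0"
  shows "lcong (cyclotomic n) 2 (qfac (e + x * int n))
           (qfac e - of_int x * (qvar powi e * (qvar ^ n - 1)))"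
proof -
  have loc: "qvar powi k \<in> localization (cyclotomic n)" for k
    by (intro loc_unitD loc_unit_power_int loc_unit_qvar n)
  have "qfac (e + x * int n) - (qfac e - of_int x * (qvar powi e * (qvar ^ n - 1))) =
      - (qvar powi e * (qvar powi (x * int n) - 1 - of_int x * (qvar ^ n - 1)))"
    by (simp add: qfac_def power_int_add algebra_simps)
  also have "\<dots> \<in> loc_ideal (cyclotomic n) 2"
    by (intro loc_ideal_uminus loc_ideal_mult_left loc loc_ideal_qvar_power_int_linear n)
  finally show ?thesis
    unfolding lcong_def
    by (intro conjI loc_diff loc_mult loc_of_int loc loc_power loc_1 loc_qfac n) auto
qed

text \<open>Since \<open>q\<^sup>n - 1\<close> is divisible by \<open>\<Phi>\<^sub>n\<close>, modulo \<open>\<Phi>\<^sub>n\<^sup>2\<close> only the sum of the three shifts matters.\<close>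

lemma lcong_qfac_shift3:
  assumes n: "n > 0" and sum: "x + y + z = 0"
  shows "lcong (cyclotomic n) 2
           (qfac (e + x * int n) * qfac (e + y * int n) * qfac (e + z * int n)) (qfac e ^ 3)"
proof -
  define f t where "f = qfac e" and "t = qvar powi e * (qvar ^ n - 1)"
  define X Y Z :: "rat poly fract" where "X = of_int x" "Y = of_int y" "Z = of_int z"
  have f: "f \<in> localization (cyclotomic n)"
    unfolding f_def by (rule loc_qfac[OF n])
  have "qvar ^ n - 1 \<in> loc_ideal (cyclotomic n) 1"
    using loc_ideal_uminus[OF loc_ideal_qfac[OF n, of "int n"]] by (simp add: qfac_def)
  then have t: "t \<in> loc_ideal (cyclotomic n) 1"
    unfolding t_def by (intro loc_ideal_mult_left loc_unitD loc_unit_power_int loc_unit_qvar n)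
  then have t': "t \<in> localization (cyclotomic n)"
    using loc_ideal_antimono[of 0 1 "cyclotomic n"] by (auto simp: loc_ideal_zero_eq)
  have tt: "t * t \<in> loc_ideal (cyclotomic n) 2"
    using loc_ideal_mult[OF t t] by (simp add: numeral_2_eq_2)
  have XYZ: "X \<in> localization (cyclotomic n)" "Y \<in> localization (cyclotomic n)"
    "Z \<in> localization (cyclotomic n)"
    by (auto simp: X_Y_Z_def intro: loc_of_int)
  have "lcong (cyclotomic n) 2
          (qfac (e + x * int n) * qfac (e + y * int n) * qfac (e + z * int n))
          ((f - X * t) * (f - Y * t) * (f - Z * t))"
    unfolding f_def t_def X_Y_Z_def by (intro lcong_mult lcong_qfac_shift n)
  also have "lcong (cyclotomic n) 2 ((f - X * t) * (f - Y * t) * (f - Z * t)) (f ^ 3)"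
  proof -
    \<comment> \<open>The coefficient of t f^2 is -(X + Y + Z), so only terms with t^2
      survive.\<close>
    have "X + Y + Z = 0"
      unfolding X_Y_Z_def of_int_add [symmetric] sum by simp
    then have "(f - X * t) * (f - Y * t) * (f - Z * t) - f ^ 3 =
        t * t * ((X * Y + X * Z + Y * Z) * f - X * Y * Z * t)"
      by algebra
    also have "\<dots> \<in> loc_ideal (cyclotomic n) 2"
      by (intro loc_ideal_mult_right[OF tt] loc_diff loc_mult loc_add XYZ f t')
    finally show ?thesis
      unfolding lcong_def by (intro conjI loc_mult loc_diff loc_power XYZ f t')
  qed
  finally show ?thesis
    unfolding f_def .
qed

lemma qshift_qvar: "qshift (qvar powi e) (qvar ^ 4) k = (\<Prod>i<k. qfac (e + 4 * int i))"
  unfolding qshift_def qfac_def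
proof (intro prod.cong refl)
  fix i
  have "(qvar ^ 4) ^ i = qvar powi (4 * int i)"
    by (simp add: power_int_mult)
  then show "1 - qvar powi e * (qvar ^ 4) ^ i = 1 - qvar powi (e + 4 * int i)"
    by (simp add: power_int_add)
qed

section \<open>Vanishing of each block of \<open>n\<close> summands\<close>

text \<open>This is (q^(v+2); q^4)_k / (q^(v+4); q^4)_k; the offset v = 4jn restarts the product at
  the j-th block.\<close>

definition qratio :: "int \<Rightarrow> nat \<Rightarrow> rat poly fract" where
  "qratio v k = (\<Prod>i<k. qfac (v + 4 * int i + 2) / qfac (v + 4 * int i + 4))"

lemma qratio_add: "qratio v (k + r) = qratio v k * qratio (v + 4 * int k) r"
  by (induction r) (simp_all add: qratio_def algebra_simps)

lemma qratio_eq_qshift: "qratio 0 k = qshift (qvar ^ 2) (qvar ^ 4) k / qshift (qvar ^ 4) (qvar ^ 4) k"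
  using qshift_qvar[of 2 k] qshift_qvar[of 4 k] by (simp add: qratio_def prod_dividef add.commute)

lemma sum_lessThan_add: "(\<Sum>k<a + b. f k) = (\<Sum>k<a. f k) + (\<Sum>k<b. f (a + k))"
  for a b :: nat and f :: "nat \<Rightarrow> 'a :: comm_monoid_add"
  by (induction b) (simp_all add: add.assoc)

context
  fixes n :: nat
  assumes n: "[n = 3] (mod 4)"
begin

private lemma n_ge: "n \<ge> 3" and n_pos: "n > 0" and odd_n: "odd n"
proof -
  have "n mod 4 = 3"
    using n by (simp add: cong_def)
  then show "n \<ge> 3" "n > 0" "odd n"
    by presburger+
qed

private lemma double_half: "2 * int ((n - 1) div 2) = int n - 1"
  using odd_n by presburger

private lemma dvd_two_power_mult_iff: "int n dvd 2 ^ k * x \<longleftrightarrow> int n dvd x"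
  using odd_n by (intro coprime_dvd_mult_right_iff) auto

text \<open>As n is odd, n dividing \<open>e\<close> would force n to divide i + 1, while 0 < i + 1
  < n.\<close>

private lemma loc_unit_qfac_4:
  assumes "e = 4 * (int i + 1) + x * int n" "Suc i < n"
  shows "loc_unit (cyclotomic n) (qfac e)"
proof (rule loc_unit_qfac[OF n_pos])
  show "\<not> int n dvd e"
  proof
    assume "int n dvd e"
    then have "int n dvd 2 ^ 2 * (int i + 1)"
      using dvd_add_left_iff[of "int n" "x * int n" "4 * (int i + 1)"] by (simp add: assms(1))
    then have "int n dvd int (Suc i)"
      unfolding dvd_two_power_mult_iff by (simp add: add.commute)
    then have "n dvd Suc i"
      unfolding int_dvd_int_iff .
    then show False
      using assms(2) by (auto dest: dvd_imp_le)
  qed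
qed

text \<open>1 + q^e = (1 - q^(2e)) / (1 - q^e), and n divides neither exponent: e is 1 modulo n, and
  n is odd and at least 3.\<close>

private lemma loc_unit_one_plus:
  assumes "e = x * int n + 1"
  shows "loc_unit (cyclotomic n) (1 + qvar powi e)"
proof -
  have ndvd: "\<not> int n dvd e"
    unfolding assms using n_ge by (simp add: dvd_add_right_iff)
  have u: "loc_unit (cyclotomic n) (qfac e)"
    using ndvd by (intro loc_unit_qfac n_pos)
  have "loc_unit (cyclotomic n) (qfac (2 * e))"
    using ndvd dvd_two_power_mult_iff[of 1 e] by (intro loc_unit_qfac n_pos) simp
  then have "loc_unit (cyclotomic n) (qfac (2 * e) / qfac e)"
    using u by (rule loc_unit_divide)
  then show ?thesis
    using u by (simp add: qfac_double loc_unit_def)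
qed

lemma loc_qratio:
  assumes "r < n"
  shows "qratio (4 * int (j * n)) r \<in> localization (cyclotomic n)"
  unfolding qratio_def
proof (intro loc_prod loc_divide loc_qfac n_pos)
  fix i assume "i \<in> {..<r}"
  then show "loc_unit (cyclotomic n) (qfac (4 * int (j * n) + 4 * int i + 4))"
    using assms by (intro loc_unit_qfac_4[of _ i "4 * int j"]) auto
qed

text \<open>The factor with index (n - 1)/2 has numerator exponent n (4j + 2); all denominators are
  units because r < n.\<close>

lemma loc_ideal_qratio:
  assumes "(n - 1) div 2 < r" "r < n"
  shows "qratio (4 * int (j * n)) r \<in> loc_ideal (cyclotomic n) 1"
  unfolding qratio_def
proof (rule loc_ideal_prod[where i = "(n - 1) div 2"])
  have unit: "loc_unit (cyclotomic n) (qfac (4 * int (j * n) + 4 * int i + 4))" if "i < r" for i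
    using assms that by (intro loc_unit_qfac_4[of _ i "4 * int j"]) auto
  then show "qfac (4 * int (j * n) + 4 * int i + 2) / qfac (4 * int (j * n) + 4 * int i + 4)
      \<in> localization (cyclotomic n)" if "i \<in> {..<r}" for i
    using that by (intro loc_divide loc_qfac n_pos) auto
  have "4 * int (j * n) + 4 * int ((n - 1) div 2) + 2 = int n * (4 * int j + 2)"
    using double_half by (simp add: algebra_simps)
  then have "int n dvd 4 * int (j * n) + 4 * int ((n - 1) div 2) + 2"
    by simp
  then show "qfac (4 * int (j * n) + 4 * int ((n - 1) div 2) + 2) /
      qfac (4 * int (j * n) + 4 * int ((n - 1) div 2) + 4) \<in> loc_ideal (cyclotomic n) 1"
    using assms by (intro loc_ideal_divide loc_ideal_qfac n_pos unit)
qed (use assms in auto)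

text \<open>In a full block, numerator and denominator each have one exponent divisible by n: 2n (2j
  + 1) at index (n - 1)/2 and 2n (2j + 2) at index n - 1. Cancelling 1 - q^(2n) leaves geometric
  sums, the lower one a unit.\<close>

lemma loc_qratio_mult: "qratio 0 (j * n) \<in> localization (cyclotomic n)"
proof (induction j)
  case 0
  show ?case by (simp add: qratio_def)
next
  case (Suc j)
  define h where "h = (n - 1) div 2"
  define A where "A = (\<Prod>i\<in>{..<n} - {h}. qfac (4 * int (j * n) + 4 * int i + 2))"
  define B where "B = (\<Prod>i\<in>{..<n} - {n - 1}. qfac (4 * int (j * n) + 4 * int i + 4))"
  define z where "z = qvar ^ (2 * n)"
  define s where "s = (\<lambda>l. \<Sum>i<l. z ^ i)"
  have hn: "h < n"
    using n_pos by (auto simp: h_def)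
  have qfac_z: "qfac (2 * int n * int l) = (1 - z) * s l" for l
  proof -
    have "qfac (2 * int n * int l) = 1 - z ^ l"
      by (simp add: qfac_def z_def power_int_mult power_mult)
    then show ?thesis
      by (simp add: s_def one_diff_power_eq)
  qed
  have z1: "1 - z \<noteq> 0"
    using qfac_nonzero[of "int (2 * n)"] n_pos unfolding qfac_def z_def power_int_of_nat by simp
  have "qratio (4 * int (j * n)) n =
      (\<Prod>i<n. qfac (4 * int (j * n) + 4 * int i + 2)) / (\<Prod>i<n. qfac (4 * int (j * n) + 4 * int i + 4))"
    by (simp add: qratio_def prod_dividef)
  also have "(\<Prod>i<n. qfac (4 * int (j * n) + 4 * int i + 2)) =
      qfac (4 * int (j * n) + 4 * int h + 2) * A"
    unfolding A_def using hn by (intro prod.remove) auto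
  also have "4 * int (j * n) + 4 * int h + 2 = 2 * int n * int (2 * j + 1)"
    using double_half by (simp add: h_def algebra_simps)
  also have "(\<Prod>i<n. qfac (4 * int (j * n) + 4 * int i + 4)) =
      qfac (4 * int (j * n) + 4 * int (n - 1) + 4) * B"
    unfolding B_def using n_pos by (intro prod.remove) auto
  also have "4 * int (j * n) + 4 * int (n - 1) + 4 = 2 * int n * int (2 * j + 2)"
    using n_pos by (simp add: algebra_simps of_nat_diff)
  also have "qfac (2 * int n * int (2 * j + 1)) * A / (qfac (2 * int n * int (2 * j + 2)) * B) =
      (s (2 * j + 1) * A) / (s (2 * j + 2) * B)"
    unfolding qfac_z using z1 by simp
  also have "\<dots> \<in> localization (cyclotomic n)"
  proof (intro loc_divide loc_mult loc_unit_mult)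
    show "s (2 * j + 1) \<in> localization (cyclotomic n)"
      unfolding s_def z_def by (intro loc_sum loc_power loc_to_fract)
    show "loc_unit (cyclotomic n) (s (2 * j + 2))"
      unfolding s_def z_def by (intro loc_unit_geometric_sum n_pos) auto
    show "A \<in> localization (cyclotomic n)"
      unfolding A_def by (intro loc_prod loc_qfac n_pos)
    show "loc_unit (cyclotomic n) B"
      unfolding B_def by (intro loc_unit_prod loc_unit_qfac_4[of _ _ "4 * int j"]) auto
  qed
  finally have "qratio (4 * int (j * n)) n \<in> localization (cyclotomic n)" .
  moreover have "qratio 0 (Suc j * n) = qratio 0 (j * n) * qratio (4 * int (j * n)) n"
    using qratio_add[of 0 "j * n" n] by (simp add: add.commute)
  ultimately show ?case
    using Suc by (simp only: loc_mult)
qed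

section \<open>Deformation into a very-well-poised series\<close>

text \<open>
  The \<open>i\<close>-th factor of the very-well-poised series with base \<open>q\<^sup>4\<close> and \<open>a = q\<^bsup>8jn+2\<^esup>\<close>,
  \<open>c = q\<^bsup>4jn+2n+2\<^esup>\<close>, \<open>d = q\<^bsup>2-2n\<^esup>\<close>, without the parameter \<open>b = q\<^bsup>4jn+1\<^esup>\<close>, which
  produces the factor \<open>1 + q\<^bsup>4k+1\<^esup>\<close> of the summand.
\<close>

private definition vwp_factor :: "nat \<Rightarrow> nat \<Rightarrow> rat poly fract" where
  "vwp_factor j i =
     qfac (8 * int (j * n) + 2 + 4 * int i) * qfac (4 * int (j * n) + 2 * int n + 2 + 4 * int i) *
       qfac (2 - 2 * int n + 4 * int i) /
     (qfac (4 + 4 * int i) * qfac (4 * int (j * n) - 2 * int n + 4 + 4 * int i) *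
       qfac (8 * int (j * n) + 2 * int n + 4 + 4 * int i))"

text \<open>Factor by factor, the shifts in units of n are 4j, 2, -4j-2 above and -4j, -2, 4j+2
  below. Both triples sum to zero, so \<open>lcong_qfac_shift3\<close> applies; the denominators are
  units because r < n.\<close>

lemma lcong_qratio_cubed:
  assumes "r < n"
  shows "lcong (cyclotomic n) 2 (qratio (4 * int (j * n)) r ^ 3) (\<Prod>i<r. vwp_factor j i)"
proof -
  have "qratio (4 * int (j * n)) r ^ 3 =
      (\<Prod>i<r. qfac (4 * int (j * n) + 4 * int i + 2) ^ 3 / qfac (4 * int (j * n) + 4 * int i + 4) ^ 3)"
    by (simp add: qratio_def prod_power_distrib power_divide)
  also have "lcong (cyclotomic n) 2 \<dots> (\<Prod>i<r. vwp_factor j i)"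
  proof (intro lcong_prod)
    fix i assume "i \<in> {..<r}"
    then have i: "Suc i < n"
      using assms by simp
    define e e' where "e = 4 * int (j * n) + 4 * int i + 2" and "e' = 4 * int (j * n) + 4 * int i + 4"
    have "vwp_factor j i =
       (qfac (e + (4 * int j) * int n) * qfac (e + 2 * int n) * qfac (e + (- 4 * int j - 2) * int n)) /
       (qfac (e' + (- 4 * int j) * int n) * qfac (e' + (- 2) * int n) * qfac (e' + (4 * int j + 2) * int n))"
      by (simp add: vwp_factor_def e_def e'_def algebra_simps)
    moreover have "lcong (cyclotomic n) 2 (qfac e ^ 3 / qfac e' ^ 3) \<dots>"
    proof (intro lcong_divide lcong_sym[OF lcong_qfac_shift3] n_pos loc_unit_power loc_unit_mult)
      show "loc_unit (cyclotomic n) (qfac e')"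
        using i by (intro loc_unit_qfac_4[of _ i "4 * int j"]) (auto simp: e'_def)
      show "loc_unit (cyclotomic n) (qfac (e' + (- 4 * int j) * int n))"
        using i by (intro loc_unit_qfac_4[of _ i 0]) (auto simp: e'_def)
      show "loc_unit (cyclotomic n) (qfac (e' + (- 2) * int n))"
        using i by (intro loc_unit_qfac_4[of _ i "4 * int j - 2"]) (auto simp: e'_def algebra_simps)
      show "loc_unit (cyclotomic n) (qfac (e' + (4 * int j + 2) * int n))"
        using i by (intro loc_unit_qfac_4[of _ i "8 * int j + 2"]) (auto simp: e'_def algebra_simps)
    qed auto
    ultimately show "lcong (cyclotomic n) 2 (qfac (4 * int (j * n) + 4 * int i + 2) ^ 3 /
        qfac (4 * int (j * n) + 4 * int i + 4) ^ 3) (vwp_factor j i)"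
      by (simp add: e_def e'_def)
  qed
  finally show ?thesis .
qed

text \<open>An instance of \<open>phi65_terminating\<close> with base q^4. Since b^2 = a, the
  quotient involving b cancels against half of the very-well-poised factor and leaves the ratio of
  the terms 1 + q^e.\<close>

lemma vwp_sum:
  fixes j :: nat
  defines "M \<equiv> (n - 1) div 2" and "v \<equiv> 4 * int (j * n)"
  shows "(\<Sum>r\<le>M. (1 + qvar powi (v + 4 * int r + 1)) / (1 + qvar powi (v + 1)) *
             (\<Prod>i<r. vwp_factor j i) * qvar ^ r) =
         (\<Prod>i<M. qfac (2 * v + 6 + 4 * int i)) * (\<Prod>i<M. qfac (3 - 2 * int n + 4 * int i)) /
         ((\<Prod>i<M. qfac (v + 5 + 4 * int i)) * (\<Prod>i<M. qfac (v + 4 - 2 * int n + 4 * int i)))"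
proof -
  define q where "q = qvar ^ 4"
  have q: "q = qvar powi 4"
    by (simp add: q_def)
  have q_pow: "q ^ i = qvar powi (4 * int i)" for i
    by (simp add: q power_int_mult)
  have P: "qvar powi e * qvar powi e' = qvar powi (e + e')" for e e'
    by (simp add: power_int_add)
  have D: "qvar powi e / qvar powi e' = qvar powi (e - e')" for e e'
    by (simp add: power_int_diff)
  define a b c d where "a = qvar powi (2 * v + 2)" and "b = qvar powi (v + 1)"
    and "c = qvar powi (v + 2 * int n + 2)" and "d = qvar powi (2 - 2 * int n)"
  have aq: "a * q = qvar powi (2 * v + 6)"
    unfolding a_def q P by (simp add: algebra_simps)
  have aqb: "a * q / b = qvar powi (v + 5)"
    unfolding aq b_def D by (simp add: algebra_simps)
  have aqc: "a * q / c = qvar powi (v + 4 - 2 * int n)"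
    unfolding aq c_def D by (simp add: algebra_simps)
  have aqd: "a * q / d = qvar powi (2 * v + 2 * int n + 4)"
    unfolding aq d_def D by (simp add: algebra_simps)
  have aqbc: "a * q / (b * c) = qvar powi (3 - 2 * int n)"
    unfolding aq b_def c_def P D by (simp add: algebra_simps)
  have aqbcd: "a * q / (b * c * d) = qvar"
    unfolding aq b_def c_def d_def P D by (simp add: algebra_simps)
  \<comment> \<open>Here 4M = 2n - 2, which is why the series terminates at M.\<close>
  have d: "1 / q ^ M = d"
  proof -
    have "0 - 4 * int M = 2 - 2 * int n"
      using double_half by (simp add: M_def)
    then show ?thesis
      using D[of 0 "4 * int M"] by (simp add: q_pow d_def)
  qed
  have ne1: "qvar powi e \<noteq> 1" if "e \<noteq> 0" for e
    using qfac_nonzero[OF that] by (simp add: qfac_def)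
  have v: "v \<ge> 0" "4 dvd v"
    by (simp_all add: v_def)
  \<comment> \<open>With b^2 = a one has aq/b = bq, so consecutive factors cancel.\<close>
  have b_telescope: "(\<Prod>i<r. qfac (v + 1 + 4 * int i)) / (\<Prod>i<r. qfac (v + 5 + 4 * int i)) =
      qfac (v + 1) / qfac (v + 1 + 4 * int r)" for r
  proof (induction r)
    case 0
    show ?case using qfac_nonzero[of "v + 1"] v by simp
  next
    case (Suc r)
    have nz: "qfac (v + 1 + 4 * int r) \<noteq> 0"
      using v by (intro qfac_nonzero) simp
    have e: "v + 1 + 4 * int (Suc r) = v + 5 + 4 * int r"
      by simp
    show ?case
      unfolding e prod.lessThan_Suc times_divide_times_eq [symmetric] Suc.IH using nz by simp
  qed
  have summand: "phi65_term q a b c d r = (1 + qvar powi (v + 4 * int r + 1)) / (1 + qvar powi (v + 1)) *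
             (\<Prod>i<r. vwp_factor j i) * qvar ^ r" for r
  proof -
    define Q where "Q = (\<lambda>e. \<Prod>i<r. qfac (e + 4 * int i))"
    have Q: "qshift (qvar powi e) q r = Q e" for e
      unfolding q_def Q_def by (rule qshift_qvar)
    have vwp: "(\<Prod>i<r. vwp_factor j i) =
        Q (2 * v + 2) * Q (v + 2 * int n + 2) * Q (2 - 2 * int n) /
        (Q 4 * Q (v + 4 - 2 * int n) * Q (2 * v + 2 * int n + 4))"
      by (simp add: Q_def vwp_factor_def prod_dividef prod.distrib v_def algebra_simps)
    have "a * q ^ (2 * r) = qvar powi (2 * (v + 4 * int r + 1))"
      unfolding a_def q_pow P by (simp add: algebra_simps)
    then have 1: "1 - a * q ^ (2 * r) = qfac (v + 4 * int r + 1) * (1 + qvar powi (v + 4 * int r + 1))"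
      unfolding qfac_double [symmetric] by (simp add: qfac_def)
    have 2: "1 - a = qfac (v + 1) * (1 + qvar powi (v + 1))"
      unfolding qfac_double [symmetric] by (simp add: qfac_def a_def algebra_simps)
    have nz: "qfac (v + 1) \<noteq> 0" "qfac (v + 4 * int r + 1) \<noteq> 0"
      using v by (auto intro!: qfac_nonzero)
    have 3: "Q (v + 1) / Q (v + 5) = qfac (v + 1) / qfac (v + 4 * int r + 1)"
      using b_telescope[of r] by (simp add: Q_def algebra_simps)
    have "phi65_term q a b c d r = qfac (v + 4 * int r + 1) * (1 + qvar powi (v + 4 * int r + 1)) /
        (qfac (v + 1) * (1 + qvar powi (v + 1))) *
        (Q (2 * v + 2) * Q (v + 1) * Q (v + 2 * int n + 2) * Q (2 - 2 * int n)) /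
        (Q 4 * Q (v + 5) * Q (v + 4 - 2 * int n) * Q (2 * v + 2 * int n + 4)) * qvar ^ r"
      unfolding phi65_term_def 1 2 aqb aqc aqd aqbcd
      unfolding a_def b_def c_def d_def Q
      using Q[of 4] by (simp add: q_def)
    also have "\<dots> = (Q (v + 1) / Q (v + 5)) * (qfac (v + 4 * int r + 1) / qfac (v + 1)) *
        ((1 + qvar powi (v + 4 * int r + 1)) / (1 + qvar powi (v + 1)) *
             (\<Prod>i<r. vwp_factor j i) * qvar ^ r)"
      unfolding vwp by (simp add: mult_ac)
    also have "(Q (v + 1) / Q (v + 5)) * (qfac (v + 4 * int r + 1) / qfac (v + 1)) = 1"
      unfolding 3 using nz by simp
    finally show ?thesis by simp
  qed
  have "(\<Sum>r\<le>M. phi65_term q a b c (1 / q ^ M) r) =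
      qshift (a * q) q M * qshift (a * q / (b * c)) q M /
      (qshift (a * q / b) q M * qshift (a * q / c) q M)"
  proof (rule phi65_terminating)
    fix i
    show "q ^ Suc i \<noteq> 1"
      unfolding q_pow by (rule ne1) simp
    show "a * q ^ i \<noteq> 1"
      unfolding a_def q_pow P using v by (intro ne1) linarith
    show "a * q / b * q ^ i \<noteq> 1"
      unfolding aqb q_pow P using v by (intro ne1) linarith
    \<comment> \<open>The exponent is 2 modulo 4, as n is odd and 4 divides v; the exponent in the
      next condition is odd.\<close>
    show "a * q / c * q ^ i \<noteq> 1"
      unfolding aqc q_pow P using v odd_n by (intro ne1) presburger
    show "a * q / (b * c) * q ^ i \<noteq> 1"
      unfolding aqbc q_pow P by (intro ne1) presburger
  qed (simp_all add: q_def a_def b_def c_def)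
  then show ?thesis
    unfolding d summand unfolding aqb aqc aqbc unfolding aq unfolding q_def qshift_qvar .
qed

text \<open>With n = 4t + 3 and M = 2t + 1, the numerator factors at i = 2t and i = t have exponents
  n (8j + 2) and -n. Each contributes one Phi_n, and the denominator is a unit.\<close>

lemma loc_ideal_vwp_sum:
  fixes j :: nat
  defines "M \<equiv> (n - 1) div 2" and "v \<equiv> 4 * int (j * n)"
  shows "(\<Sum>r\<le>M. (1 + qvar powi (v + 4 * int r + 1)) / (1 + qvar powi (v + 1)) *
             (\<Prod>i<r. vwp_factor j i) * qvar ^ r) \<in> loc_ideal (cyclotomic n) 2"
proof -
  obtain t where t: "n = 4 * t + 3"
  proof -
    have "n mod 4 = 3"
      using n by (simp add: cong_def)
    then have "n = 4 * (n div 4) + 3"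
      by presburger
    then show ?thesis using that by blast
  qed
  have M: "M = 2 * t + 1"
    by (simp add: M_def t)
  have "(\<Prod>i<M. qfac (2 * v + 6 + 4 * int i)) \<in> loc_ideal (cyclotomic n) 1"
  proof (rule loc_ideal_prod[where i = "2 * t"])
    have "2 * v + 6 + 4 * int (2 * t) = int n * (8 * int j + 2)"
      by (simp add: v_def t algebra_simps)
    then have "int n dvd 2 * v + 6 + 4 * int (2 * t)"
      by (simp only: dvd_triv_left)
    then show "qfac (2 * v + 6 + 4 * int (2 * t)) \<in> loc_ideal (cyclotomic n) 1"
      by (intro loc_ideal_qfac n_pos)
  qed (auto simp: M intro: loc_qfac n_pos)
  moreover have "(\<Prod>i<M. qfac (3 - 2 * int n + 4 * int i)) \<in> loc_ideal (cyclotomic n) 1"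
  proof (rule loc_ideal_prod[where i = t])
    have "3 - 2 * int n + 4 * int t = - int n"
      by (simp add: t)
    then have "int n dvd 3 - 2 * int n + 4 * int t"
      by (simp only: dvd_minus_iff dvd_refl)
    then show "qfac (3 - 2 * int n + 4 * int t) \<in> loc_ideal (cyclotomic n) 1"
      by (intro loc_ideal_qfac n_pos)
  qed (auto simp: M intro: loc_qfac n_pos)
  ultimately have "(\<Prod>i<M. qfac (2 * v + 6 + 4 * int i)) * (\<Prod>i<M. qfac (3 - 2 * int n + 4 * int i))
      \<in> loc_ideal (cyclotomic n) (1 + 1)"
    by (rule loc_ideal_mult)
  moreover have "loc_unit (cyclotomic n) (\<Prod>i<M. qfac (v + 5 + 4 * int i))"
  proof (intro loc_unit_prod loc_unit_qfac n_pos notI)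
    fix i assume "i \<in> {..<M}" and dvd: "int n dvd v + 5 + 4 * int i"
    then have i: "i \<le> 2 * t"
      by (simp add: M)
    have "v + 5 + 4 * int i = int n * (4 * int j) + (4 * int i + 5)"
      by (simp add: v_def)
    with dvd have "int n dvd 4 * int i + 5"
      by (simp add: dvd_add_right_iff)
    \<comment> \<open>From i \<le> 2t follows 4i + 5 \<le> 8t + 5 < 2n, so x = 1; but 4i + 5 is 1
      modulo 4 and n is 3 modulo 4.\<close>
    then obtain x where x: "4 * int i + 5 = int n * x"
      by blast
    have "0 < int n * x"
      using x by linarith
    then have "x > 0"
      using n_pos by (simp add: zero_less_mult_iff)
    moreover have "x < 2"
    proof (rule ccontr)
      assume "\<not> x < 2"
      then have "int n * 2 \<le> int n * x"
        by (intro mult_left_mono) auto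
      then show False
        using x i t by linarith
    qed
    ultimately have "x = 1"
      by simp
    then show False
      using x t by simp presburger
  qed
  moreover have "loc_unit (cyclotomic n) (\<Prod>i<M. qfac (v + 4 - 2 * int n + 4 * int i))"
    by (intro loc_unit_prod loc_unit_qfac_4[of _ _ "4 * int j - 2"])
       (auto simp: v_def M t algebra_simps)
  ultimately show ?thesis
    unfolding vwp_sum[of j, folded M_def v_def] one_add_one
    by (intro loc_ideal_divide loc_unit_mult)
qed

section \<open>Summation over the blocks\<close>

private definition summand :: "nat \<Rightarrow> rat poly fract" where
  "summand k = (1 + qvar ^ (4 * k + 1)) / (1 + qvar) * qratio 0 k ^ 3 * qvar ^ k"

private lemma loc_unit_one_plus_qvar: "loc_unit (cyclotomic n) (1 + qvar)"
  using loc_unit_one_plus[of 1 0] by simp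

text \<open>Everything independent of \<open>r\<close> is pulled out. By
  \<open>loc_qratio_mult\<close> this prefactor lies in the localization, so divisibility need only
  be shown for the remaining factor.\<close>

private lemma summand_block:
  "summand (j * n + r) = qratio 0 (j * n) ^ 3 * qvar ^ (j * n) * (1 / (1 + qvar)) *
     ((1 + qvar powi (4 * int (j * n) + 4 * int r + 1)) * qratio (4 * int (j * n)) r ^ 3 * qvar ^ r)"
proof -
  have "qvar ^ (4 * (j * n + r) + 1) = qvar powi int (4 * (j * n + r) + 1)"
    by (rule power_int_of_nat [symmetric])
  also have "int (4 * (j * n + r) + 1) = 4 * int (j * n) + 4 * int r + 1"
    by simp
  finally show ?thesis
    by (simp add: summand_def qratio_add power_add power_mult_distrib)
qed

private lemma loc_block_prefactor:
  "qratio 0 (j * n) ^ 3 * qvar ^ (j * n) * (1 / (1 + qvar)) \<in> localization (cyclotomic n)"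
  by (intro loc_mult loc_power loc_qratio_mult loc_divide loc_unit_one_plus_qvar loc_1 loc_to_fract)

lemma loc_ideal_half_block:
  "(\<Sum>r\<le>(n - 1) div 2. summand (j * n + r)) \<in> loc_ideal (cyclotomic n) 2"
proof -
  define M v where "M = (n - 1) div 2" and "v = 4 * int (j * n)"
  have Mn: "M < n"
    using n_pos by (auto simp: M_def)
  have loc: "qvar powi k \<in> localization (cyclotomic n)" for k
    by (intro loc_unitD loc_unit_power_int loc_unit_qvar n_pos)
  have u: "loc_unit (cyclotomic n) (1 + qvar powi (v + 1))"
    by (rule loc_unit_one_plus[of _ "4 * int j"]) (simp add: v_def)
  \<comment> \<open>Dividing by the unit 1 + q^(v+1) gives the normalization of the series in
    \<open>vwp_sum\<close>.\<close>
  define S where "S = (\<Sum>r\<le>M. (1 + qvar powi (v + 4 * int r + 1)) / (1 + qvar powi (v + 1)) *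
             qratio v r ^ 3 * qvar ^ r)"
  have "lcong (cyclotomic n) 2 S
      (\<Sum>r\<le>M. (1 + qvar powi (v + 4 * int r + 1)) / (1 + qvar powi (v + 1)) *
             (\<Prod>i<r. vwp_factor j i) * qvar ^ r)"
    unfolding S_def
  proof (intro lcong_sum lcong_mult)
    fix r assume "r \<in> {..M}"
    then show "lcong (cyclotomic n) 2 (qratio v r ^ 3) (\<Prod>i<r. vwp_factor j i)"
      unfolding v_def using Mn by (intro lcong_qratio_cubed) simp
  qed (intro lcong_refl loc_divide loc_add loc_1 loc u loc_power loc_to_fract)+
  then have S: "S \<in> loc_ideal (cyclotomic n) 2"
    using loc_ideal_vwp_sum[of j] unfolding M_def v_def by (rule lcong_idealD)
  have "(\<Sum>r\<le>M. summand (j * n + r)) =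
      qratio 0 (j * n) ^ 3 * qvar ^ (j * n) * (1 / (1 + qvar)) * ((1 + qvar powi (v + 1)) * S)"
    unfolding S_def summand_block v_def[symmetric] sum_distrib_left
    using u by (intro sum.cong refl) (simp add: loc_unit_def)
  also have "\<dots> \<in> loc_ideal (cyclotomic n) 2"
    by (intro loc_ideal_mult_left loc_block_prefactor loc_unitD[OF u] S)
  finally show ?thesis
    unfolding M_def .
qed

text \<open>Beyond the half block each summand contains the cube of an element divisible by Phi_n,
  hence Phi_n^2.\<close>

lemma loc_ideal_block: "(\<Sum>r<n. summand (j * n + r)) \<in> loc_ideal (cyclotomic n) 2"
proof -
  define M where "M = (n - 1) div 2"
  have Mn: "M < n"
    using n_pos by (auto simp: M_def)
  then have split: "{..<n} = {..M} \<union> {M<..<n}"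
    by auto
  have "(\<Sum>r<n. summand (j * n + r)) =
      (\<Sum>r\<le>M. summand (j * n + r)) + (\<Sum>r\<in>{M<..<n}. summand (j * n + r))"
    unfolding split by (rule sum.union_disjoint) auto
  also have "\<dots> \<in> loc_ideal (cyclotomic n) 2"
  proof (rule loc_ideal_add)
    show "(\<Sum>r\<le>M. summand (j * n + r)) \<in> loc_ideal (cyclotomic n) 2"
      unfolding M_def by (rule loc_ideal_half_block)
    show "(\<Sum>r\<in>{M<..<n}. summand (j * n + r)) \<in> loc_ideal (cyclotomic n) 2"
    proof (rule loc_ideal_sum)
      fix r assume r: "r \<in> {M<..<n}"
      have R: "qratio (4 * int (j * n)) r \<in> loc_ideal (cyclotomic n) 1"
        using r by (intro loc_ideal_qratio) (auto simp: M_def)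
      have "qratio (4 * int (j * n)) r ^ 3 =
          qratio (4 * int (j * n)) r * qratio (4 * int (j * n)) r * qratio (4 * int (j * n)) r"
        by (simp add: power3_eq_cube)
      also have "\<dots> \<in> loc_ideal (cyclotomic n) (1 + 1)"
        using r by (intro loc_ideal_mult_right[OF loc_ideal_mult[OF R R]] loc_qratio) auto
      finally have R3: "qratio (4 * int (j * n)) r ^ 3 \<in> loc_ideal (cyclotomic n) 2"
        unfolding one_add_one .
      show "summand (j * n + r) \<in> loc_ideal (cyclotomic n) 2"
        unfolding summand_block
        by (intro loc_ideal_mult_left loc_block_prefactor loc_ideal_mult_right R3 loc_add loc_1
            loc_unitD[OF loc_unit_power_int] loc_unit_qvar n_pos loc_power loc_to_fract)
    qed
  qed
  finally show ?thesis .
qed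

lemma loc_ideal_full_sum: "(\<Sum>k<m * n. summand k) \<in> loc_ideal (cyclotomic n) 2"
proof -
  have "(\<Sum>k<m * n. summand k) = (\<Sum>j<m. \<Sum>r<n. summand (j * n + r))"

    by (induction m) (simp_all add: sum_lessThan_add add.commute[of n])
  also have "\<dots> \<in> loc_ideal (cyclotomic n) 2"
    by (intro loc_ideal_sum loc_ideal_block)
  finally show ?thesis .
qed

text \<open>The range splits into m full blocks and the half block with j = m.\<close>

lemma loc_ideal_full_sum_plus_half:
  "(\<Sum>k\<le>m * n + (n - 1) div 2. summand k) \<in> loc_ideal (cyclotomic n) 2"
proof -
  have "(\<Sum>k\<le>m * n + (n - 1) div 2. summand k) =
      (\<Sum>k<m * n. summand k) + (\<Sum>r\<le>(n - 1) div 2. summand (m * n + r))"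
    using sum_lessThan_add[of summand "m * n" "Suc ((n - 1) div 2)"]
    by (simp only: lessThan_Suc_atMost add_Suc_right)
  then show ?thesis
    by (simp only: loc_ideal_add loc_ideal_full_sum loc_ideal_half_block)
qed

lemma summand_eq:
  "((1 + qvar ^ (4 * k + 1)) * qshift (qvar ^ 2) (qvar ^ 4) k ^ 3) /
   ((1 + qvar) * qshift (qvar ^ 4) (qvar ^ 4) k ^ 3) * qvar ^ k = summand k"
  by (simp add: summand_def qratio_eq_qshift power_divide)

lemma sum_cong_zero_mult:
  assumes "m > 0"
  shows "ratfun_cong (\<Sum>k=0..m * n - 1.
              ((1 + qvar ^ (4 * k + 1)) * qshift (qvar ^ 2) (qvar ^ 4) k ^ 3) /
              ((1 + qvar) * qshift (qvar ^ 4) (qvar ^ 4) k ^ 3) * qvar ^ k) 0 (cyclotomic n ^ 2)"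
proof -
  \<comment> \<open>Positivity makes \<open>m * n - 1\<close> the true predecessor under truncated
    subtraction; for 0 the range would still contain k = 0.\<close>
  have "m * n > 0"
    using assms n_pos by simp
  then obtain l where l: "m * n = Suc l"
    using gr0_implies_Suc by blast
  have "{0..m * n - 1} = {..<m * n}"
    unfolding l by (simp add: atLeast0AtMost lessThan_Suc_atMost)
  then have "(\<Sum>k=0..m * n - 1. summand k) \<in> loc_ideal (cyclotomic n) 2"
    using loc_ideal_full_sum by simp
  then show ?thesis
    unfolding summand_eq by (rule ratfun_cong_0I)
qed

lemma sum_cong_zero_mult_plus_half:
  "ratfun_cong (\<Sum>k=0..m * n + (n - 1) div 2.
              ((1 + qvar ^ (4 * k + 1)) * qshift (qvar ^ 2) (qvar ^ 4) k ^ 3) /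
              ((1 + qvar) * qshift (qvar ^ 4) (qvar ^ 4) k ^ 3) * qvar ^ k) 0 (cyclotomic n ^ 2)"
  unfolding summand_eq atLeast0AtMost by (intro ratfun_cong_0I loc_ideal_full_sum_plus_half)

end

theorem theorem1p1:
  fixes m n :: nat
  assumes "m > 0" and "n > 0" and "[n = 3] (mod 4)"
  shows "ratfun_cong
           (\<Sum>k=0..m * n - 1.
              ((1 + qvar ^ (4 * k + 1)) * qshift (qvar ^ 2) (qvar ^ 4) k ^ 3) /
              ((1 + qvar) * qshift (qvar ^ 4) (qvar ^ 4) k ^ 3) * qvar ^ k)
           0 (cyclotomic n ^ 2) \<and>
         ratfun_cong
           (\<Sum>k=0..m * n + (n - 1) div 2.
              ((1 + qvar ^ (4 * k + 1)) * qshift (qvar ^ 2) (qvar ^ 4) k ^ 3) /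
              ((1 + qvar) * qshift (qvar ^ 4) (qvar ^ 4) k ^ 3) * qvar ^ k)
           0 (cyclotomic n ^ 2)"
  using sum_cong_zero_mult[OF assms(3,1)] sum_cong_zero_mult_plus_half[OF assms(3)] by (rule conjI)

end
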